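(* Let $X$ be a compact metrizable space and $T:X\to X$ a homeomorphism. Let $\tilde U_T$ be the operator induced by $U_T:\phi\mapsto\phi\circ T$ on the quotient Banach space $C(X)/\overline{B_T(X)}$. Then $$\mathrm{Mult}(\tilde U_T)=\sharp\mathcal M_e(X,T)$$ as an equality in $\mathbb N\cup\{\infty\}$.
   Context: $C(X)$ is the Banach space of real continuous functions on $X$ with the supremum norm. $B_T(X)=\{\phi\circ T-\phi:\phi\in C(X)\}$ is the space of continuous $T$-coboundaries and $\overline{B_T(X)}$ is its closure in $C(X)$; it is invariant under $U_T$, and the quotient carries the quotient norm. $\mathcal M_e(X,T)$ is the set of ergodic $T$-invariant Borel probability measures on $X$, and $\sharp$ denotes cardinality (with value $\infty$ for any infinite set). For an invertible bounded linear operator $U$ on a real normed space $E$, $\mathrm{Mult}(U)\in\mathbb N\cup\{\infty\}$ is the smallest cardinality of a set $F\subset E$ such that the linear span of $\{U^n x: x\in F,\ n\in\mathbb Z\}$ is dense in $E$ (it is $0$ if $E=\{0\}$ and $\infty$ if no finite such $F$ exists). *)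

theory Defs
  imports
    "HOL-Probability.Probability"
    "HOL-Library.Set_Algebras"
    "HOL-Library.Extended_Nat"
begin

section \<open>Real normed spaces with an explicit carrier\<close>

text \<open>
  The quotient of \<open>C(X)\<close> by the closure of the coboundaries depends on the map \<open>T\<close>, so it cannot
  be a type of class \<^class>\<open>real_normed_vector\<close>. Normed spaces are therefore records here.
\<close>

record 'v nspace =
  nv_carrier :: "'v set"
  nv_zero :: 'v
  nv_add :: "'v \<Rightarrow> 'v \<Rightarrow> 'v"
  nv_scale :: "real \<Rightarrow> 'v \<Rightarrow> 'v"
  nv_norm :: "'v \<Rightarrow> real"

definition nv_minus :: "'v nspace \<Rightarrow> 'v \<Rightarrow> 'v \<Rightarrow> 'v" where
  "nv_minus E x y = nv_add E x (nv_scale E (- 1) y)"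

locale normed_space =
  fixes E :: "'v nspace"
  assumes zero_closed: "nv_zero E \<in> nv_carrier E"
    and add_closed: "\<lbrakk>x \<in> nv_carrier E; y \<in> nv_carrier E\<rbrakk> \<Longrightarrow> nv_add E x y \<in> nv_carrier E"
    and scale_closed: "x \<in> nv_carrier E \<Longrightarrow> nv_scale E c x \<in> nv_carrier E"
    and add_assoc: "\<lbrakk>x \<in> nv_carrier E; y \<in> nv_carrier E; z \<in> nv_carrier E\<rbrakk>
      \<Longrightarrow> nv_add E (nv_add E x y) z = nv_add E x (nv_add E y z)"
    and add_commute: "\<lbrakk>x \<in> nv_carrier E; y \<in> nv_carrier E\<rbrakk> \<Longrightarrow> nv_add E x y = nv_add E y x"
    and add_zero: "x \<in> nv_carrier E \<Longrightarrow> nv_add E (nv_zero E) x = x"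
    and minus_self: "x \<in> nv_carrier E \<Longrightarrow> nv_minus E x x = nv_zero E"
    and scale_add_right: "\<lbrakk>x \<in> nv_carrier E; y \<in> nv_carrier E\<rbrakk>
      \<Longrightarrow> nv_scale E c (nv_add E x y) = nv_add E (nv_scale E c x) (nv_scale E c y)"
    and scale_add_left: "x \<in> nv_carrier E
      \<Longrightarrow> nv_scale E (c + d) x = nv_add E (nv_scale E c x) (nv_scale E d x)"
    and scale_scale: "x \<in> nv_carrier E \<Longrightarrow> nv_scale E c (nv_scale E d x) = nv_scale E (c * d) x"
    and scale_one: "x \<in> nv_carrier E \<Longrightarrow> nv_scale E 1 x = x"
    and norm_eq_zero: "x \<in> nv_carrier E \<Longrightarrow> nv_norm E x = 0 \<longleftrightarrow> x = nv_zero E"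
    and norm_triangle: "\<lbrakk>x \<in> nv_carrier E; y \<in> nv_carrier E\<rbrakk>
      \<Longrightarrow> nv_norm E (nv_add E x y) \<le> nv_norm E x + nv_norm E y"
    and norm_scale: "x \<in> nv_carrier E \<Longrightarrow> nv_norm E (nv_scale E c x) = \<bar>c\<bar> * nv_norm E x"

inductive_set nv_span :: "'v nspace \<Rightarrow> 'v set \<Rightarrow> 'v set" for E S where
  zero: "nv_zero E \<in> nv_span E S"
| base: "x \<in> S \<Longrightarrow> x \<in> nv_span E S"
| add: "\<lbrakk>x \<in> nv_span E S; y \<in> nv_span E S\<rbrakk> \<Longrightarrow> nv_add E x y \<in> nv_span E S"
| scale: "x \<in> nv_span E S \<Longrightarrow> nv_scale E c x \<in> nv_span E S"

definition nv_dense :: "'v nspace \<Rightarrow> 'v set \<Rightarrow> bool" where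
  "nv_dense E D \<longleftrightarrow> (\<forall>x\<in>nv_carrier E. \<forall>e>0. \<exists>y\<in>D. nv_norm E (nv_minus E x y) < e)"


section \<open>Multiplicity of an invertible operator\<close>

definition ecard :: "'a set \<Rightarrow> enat" where
  "ecard A = (if finite A then enat (card A) else \<infinity>)"

definition nv_power_int :: "'v nspace \<Rightarrow> ('v \<Rightarrow> 'v) \<Rightarrow> int \<Rightarrow> 'v \<Rightarrow> 'v" where
  "nv_power_int E U n =
     (if 0 \<le> n then U ^^ nat n else inv_into (nv_carrier E) U ^^ nat (- n))"

text \<open>
  Meaningful when \<open>U\<close> is a bijection of the carrier of \<open>E\<close>. In \<^typ>\<open>enat\<close> the infimum of the
  empty set is \<open>\<infinity>\<close>, and every nonempty infimum is attained.
\<close>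

definition Mult :: "'v nspace \<Rightarrow> ('v \<Rightarrow> 'v) \<Rightarrow> enat" where
  "Mult E U = Inf {ecard F | F. F \<subseteq> nv_carrier E \<and>
     nv_dense E (nv_span E {nv_power_int E U n x | n x. x \<in> F})}"


section \<open>Quotient spaces\<close>

text \<open>
  The elements of the quotient by a closed subspace \<open>N\<close> are the cosets \<open>x +o N\<close>. Adding \<open>N\<close> in
  the scalar multiplication matters only for the scalar \<open>0\<close>, where the image alone is \<open>{0}\<close>.
\<close>

definition quotient_nspace :: "'v::real_normed_vector set \<Rightarrow> 'v set nspace" where
  "quotient_nspace N =
     \<lparr> nv_carrier = range (\<lambda>x. x +o N),
       nv_zero = N,
       nv_add = (\<lambda>A B. A + B),
       nv_scale = (\<lambda>c A. (\<lambda>x. c *\<^sub>R x) ` A + N),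
       nv_norm = (\<lambda>A. INF x\<in>A. norm x) \<rparr>"

text \<open>For linear \<open>U\<close> with \<open>U ` N \<subseteq> N\<close> this is the map \<open>x +o N \<mapsto> U x +o N\<close>.\<close>

definition induced_map :: "'v::real_normed_vector set \<Rightarrow> ('v \<Rightarrow> 'v) \<Rightarrow> 'v set \<Rightarrow> 'v set" where
  "induced_map N U A = U ` A + N"

lemma coset_iff: "z \<in> x +o N \<longleftrightarrow> z - x \<in> N" for x :: "'v::real_normed_vector"
  unfolding elt_set_plus_def by (auto intro: bexI[of _ "z - x"])

lemma coset_add:
  fixes N :: "'v::real_normed_vector set"
  assumes "subspace N"
  shows "(x +o N) + (y +o N) = (x + y) +o N"
proof (intro set_eqI iffI)
  fix z assume "z \<in> (x +o N) + (y +o N)"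
  then obtain a b where z: "z = a + b" and "a - x \<in> N" "b - y \<in> N"
    by (auto simp: set_plus_def coset_iff)
  then have "(a - x) + (b - y) \<in> N" using assms by (intro subspace_add)
  then show "z \<in> (x + y) +o N" by (simp add: coset_iff z algebra_simps)
next
  fix z assume "z \<in> (x + y) +o N"
  then have "z - y \<in> x +o N" by (simp add: coset_iff algebra_simps)
  moreover have "y \<in> y +o N" using assms by (simp add: coset_iff subspace_0)
  ultimately have "(z - y) + y \<in> (x +o N) + (y +o N)" by (rule set_plus_intro)
  then show "z \<in> (x +o N) + (y +o N)" by simp
qed

lemma induced_map_coset:
  fixes U :: "'v::real_normed_vector \<Rightarrow> 'v"
  assumes "linear U" "subspace N" "U ` N \<subseteq> N"
  shows "induced_map N U (x +o N) = U x +o N"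
proof (intro set_eqI iffI)
  fix z assume "z \<in> induced_map N U (x +o N)"
  then obtain a b where z: "z = U a + b" and a: "a - x \<in> N" and b: "b \<in> N"
    by (auto simp: induced_map_def set_plus_def coset_iff)
  have "U (a - x) \<in> N" using a assms(3) by auto
  then have "U (a - x) + b \<in> N" using b assms(2) by (intro subspace_add)
  then show "z \<in> U x +o N" by (simp add: coset_iff z linear_diff[OF assms(1)] algebra_simps)
next
  fix z assume "z \<in> U x +o N"
  then have "z - U x \<in> N" by (simp add: coset_iff)
  moreover have "U x \<in> U ` (x +o N)" using assms(2) by (simp add: coset_iff subspace_0)
  ultimately have "U x + (z - U x) \<in> U ` (x +o N) + N" by (intro set_plus_intro)
  then show "z \<in> induced_map N U (x +o N)" by (simp add: induced_map_def)
qed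

lemma coset_scale:
  fixes N :: "'v::real_normed_vector set"
  assumes "subspace N"
  shows "(\<lambda>x. c *\<^sub>R x) ` (x +o N) + N = (c *\<^sub>R x) +o N"
proof -
  have "linear (\<lambda>x::'v. c *\<^sub>R x)" by (rule linear_scaleR)
  moreover have "(\<lambda>x. c *\<^sub>R x) ` N \<subseteq> N" using assms by (auto intro: subspace_scale)
  ultimately show ?thesis
    using induced_map_coset[of "\<lambda>x. c *\<^sub>R x" N x] assms by (simp add: induced_map_def)
qed

lemma coset_eq_iff:
  fixes N :: "'v::real_normed_vector set"
  assumes "subspace N"
  shows "x +o N = y +o N \<longleftrightarrow> x - y \<in> N"
proof
  assume "x +o N = y +o N"
  moreover have "x \<in> x +o N" using assms by (simp add: coset_iff subspace_0)
  ultimately show "x - y \<in> N" by (simp add: coset_iff)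
next
  assume *: "x - y \<in> N"
  show "x +o N = y +o N"
  proof (intro set_eqI)
    fix z
    have "z - x \<in> N \<longleftrightarrow> z - y \<in> N"
      using subspace_add[OF assms, of "z - x" "x - y"] subspace_diff[OF assms, of "z - y" "x - y"] *
      by auto
    then show "z \<in> x +o N \<longleftrightarrow> z \<in> y +o N" by (simp add: coset_iff)
  qed
qed

lemma coset_norm:
  fixes N :: "'v::real_normed_vector set"
  assumes "subspace N"
  shows "(INF z\<in>x +o N. norm z) = infdist x N"
proof -
  have "norm ` (x +o N) = dist x ` N"
  proof (intro set_eqI iffI)
    fix r assume "r \<in> norm ` (x +o N)"
    then obtain b where "b \<in> N" "r = norm (x + b)" by (auto simp: elt_set_plus_def)
    then show "r \<in> dist x ` N"
      using assms by (intro image_eqI[of _ _ "- b"]) (auto simp: dist_norm subspace_neg)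
  next
    fix r assume "r \<in> dist x ` N"
    then obtain b where "b \<in> N" "r = norm (x - b)" by (auto simp: dist_norm)
    then show "r \<in> norm ` (x +o N)"
      using assms by (intro image_eqI[of _ _ "x - b"]) (auto simp: coset_iff subspace_neg)
  qed
  moreover have "N \<noteq> {}" using assms subspace_0 by auto
  ultimately show ?thesis by (simp add: infdist_def)
qed

lemma infdist_subspace_add:
  fixes N :: "'v::real_normed_vector set"
  assumes "subspace N"
  shows "infdist (x + y) N \<le> infdist x N + infdist y N"
proof (rule field_le_epsilon)
  fix e :: real assume e: "0 < e"
  have ne: "N \<noteq> {}" using assms subspace_0 by auto
  have *: "\<exists>a\<in>N. dist u a < infdist u N + e / 2" for u
  proof -
    have "(INF a\<in>N. dist u a) < infdist u N + e / 2" using e ne by (simp add: infdist_def)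
    then show ?thesis by (subst (asm) cINF_less_iff) (use ne in auto)
  qed
  obtain a b where a: "a \<in> N" "dist x a < infdist x N + e / 2"
    and b: "b \<in> N" "dist y b < infdist y N + e / 2" using * by blast
  have "infdist (x + y) N \<le> dist (x + y) (a + b)"
    using a b assms by (intro infdist_le subspace_add)
  also have "\<dots> \<le> dist x a + dist y b" by (rule dist_triangle_add)
  finally show "infdist (x + y) N \<le> infdist x N + infdist y N + e" using a b by linarith
qed

lemma infdist_subspace_scale_le:
  fixes N :: "'v::real_normed_vector set"
  assumes "subspace N" "c \<noteq> 0"
  shows "infdist (c *\<^sub>R x) N \<le> \<bar>c\<bar> * infdist x N"
proof -
  have ne: "N \<noteq> {}" using assms subspace_0 by auto
  have "infdist (c *\<^sub>R x) N / \<bar>c\<bar> \<le> dist x a" if "a \<in> N" for a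
  proof -
    have "infdist (c *\<^sub>R x) N \<le> dist (c *\<^sub>R x) (c *\<^sub>R a)"
      using that assms by (intro infdist_le subspace_scale)
    also have "\<dots> = \<bar>c\<bar> * dist x a" by (simp add: dist_norm flip: scaleR_diff_right)
    finally show ?thesis using assms(2) by (simp add: field_simps)
  qed
  then have "infdist (c *\<^sub>R x) N / \<bar>c\<bar> \<le> infdist x N"
    using ne by (simp add: infdist_def cINF_greatest)
  then show ?thesis using assms(2) by (simp add: field_simps)
qed

lemma infdist_subspace_scale:
  fixes N :: "'v::real_normed_vector set"
  assumes "subspace N"
  shows "infdist (c *\<^sub>R x) N = \<bar>c\<bar> * infdist x N"
proof (cases "c = 0")
  case True
  then show ?thesis using assms by (simp add: subspace_0)
next
  case False
  have "infdist x N \<le> \<bar>1 / c\<bar> * infdist (c *\<^sub>R x) N"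
    using infdist_subspace_scale_le[OF assms, of "1 / c" "c *\<^sub>R x"] False by simp
  then have "\<bar>c\<bar> * infdist x N \<le> infdist (c *\<^sub>R x) N" using False by (simp add: field_simps)
  then show ?thesis using infdist_subspace_scale_le[OF assms False, of x] by simp
qed

lemma normed_space_quotient_nspace:
  fixes N :: "'v::real_normed_vector set"
  assumes N: "subspace N" and cl: "closed N"
  shows "normed_space (quotient_nspace N)"
proof -
  have ne: "N \<noteq> {}" using N subspace_0 by auto
  have addN: "(x +o N) + N = x +o N" for x using coset_add[OF N, of x 0] by simp
  show ?thesis
  proof (unfold_locales, goal_cases)
    case 1
    show ?case using range_eqI[where f = "\<lambda>x. x +o N" and b = N and x = 0] by (simp add: quotient_nspace_def)
  next
    case (2 x y)
    then show ?case by (auto simp: quotient_nspace_def coset_add[OF N])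
  next
    case (3 x c)
    then show ?case by (auto simp: quotient_nspace_def coset_scale[OF N])
  next
    case (6 x)
    then obtain a where "x = a +o N" by (auto simp: quotient_nspace_def)
    then show ?case using coset_add[OF N, of 0 a] by (simp add: quotient_nspace_def)
  next
    case (7 x)
    then obtain a where "x = a +o N" by (auto simp: quotient_nspace_def)
    then show ?case
      by (simp add: quotient_nspace_def nv_minus_def coset_scale[OF N, of "- 1", simplified] coset_add[OF N])
  next
    case (12 x)
    then obtain a where a: "x = a +o N" by (auto simp: quotient_nspace_def)
    have "infdist a N = 0 \<longleftrightarrow> a \<in> N" using cl ne by (simp add: in_closed_iff_infdist_zero)
    also have "\<dots> \<longleftrightarrow> x = N" using coset_eq_iff[OF N, of a 0] a by simp
    finally show ?case by (simp add: quotient_nspace_def a coset_norm[OF N])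
  next
    case (4 x y z)
    then show ?case by (auto simp: quotient_nspace_def coset_add[OF N] add.assoc)
  next
    case (9 x c d)
    then obtain a where "x = a +o N" by (auto simp: quotient_nspace_def)
    then show ?case
      using coset_scale[OF N, of "c + d" a]
      by (simp add: quotient_nspace_def coset_add[OF N] coset_scale[OF N] scaleR_add_left)
  next
    case (5 x y)
    then show ?case by (auto simp: quotient_nspace_def coset_add[OF N] add.commute)
  qed (auto simp: quotient_nspace_def coset_add[OF N] coset_scale[OF N] coset_norm[OF N] addN
        infdist_subspace_add[OF N] infdist_subspace_scale[OF N] scaleR_add_right)
qed


section \<open>Koopman operator, coboundaries and ergodic measures\<close>

text \<open>
  For a compact space \<open>X\<close> the type \<open>X \<Rightarrow>\<^sub>C real\<close> of bounded continuous functions is \<open>C(X)\<close> with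
  the supremum norm. Being built with \<^const>\<open>Bcontfun\<close>, the next constant is unspecified unless
  \<open>\<phi> \<circ> T\<close> is continuous.
\<close>

definition koopman :: "('a::topological_space \<Rightarrow> 'a) \<Rightarrow> ('a \<Rightarrow>\<^sub>C real) \<Rightarrow> ('a \<Rightarrow>\<^sub>C real)" where
  "koopman T \<phi> = Bcontfun (apply_bcontfun \<phi> \<circ> T)"

lemma apply_koopman:
  assumes "continuous_on UNIV T"
  shows "apply_bcontfun (koopman T \<phi>) x = apply_bcontfun \<phi> (T x)"
proof -
  have "continuous_on UNIV (apply_bcontfun \<phi> \<circ> T)"
    using assms by (intro continuous_on_compose) auto
  moreover have "bounded (range (apply_bcontfun \<phi> \<circ> T))"
    by (rule bounded_subset[OF bounded_apply_bcontfun[of \<phi>]]) auto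
  ultimately show ?thesis by (simp add: koopman_def Bcontfun_inverse bcontfun_def)
qed

definition coboundaries :: "('a::topological_space \<Rightarrow> 'a) \<Rightarrow> ('a \<Rightarrow>\<^sub>C real) set" where
  "coboundaries T = range (\<lambda>\<phi>. koopman T \<phi> - \<phi>)"

lemma linear_koopman: "continuous_on UNIV T \<Longrightarrow> linear (koopman T)"
  by (rule linearI) (auto intro!: bcontfun_eqI simp: apply_koopman)

lemma subspace_closure:
  fixes N :: "'v::real_normed_vector set"
  assumes "subspace N"
  shows "subspace (closure N)"
proof (rule subspaceI)
  show "0 \<in> closure N" using subspace_0[OF assms] closure_subset by blast
next
  fix x y assume "x \<in> closure N" "y \<in> closure N"
  then obtain f g where "\<And>n. f n \<in> N" "f \<longlonglongrightarrow> x" "\<And>n. g n \<in> N" "g \<longlonglongrightarrow> y"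
    unfolding closure_sequential by blast
  then show "x + y \<in> closure N"
    unfolding closure_sequential using subspace_add[OF assms]
    by (intro exI[of _ "\<lambda>n. f n + g n"]) (auto intro: tendsto_add)
next
  fix c :: real and x assume "x \<in> closure N"
  then obtain f where "\<And>n. f n \<in> N" "f \<longlonglongrightarrow> x"
    unfolding closure_sequential by blast
  then show "c *\<^sub>R x \<in> closure N"
    unfolding closure_sequential using subspace_scale[OF assms]
    by (intro exI[of _ "\<lambda>n. c *\<^sub>R f n"]) (auto intro: tendsto_scaleR)
qed

lemma subspace_closure_coboundaries:
  assumes "continuous_on UNIV T"
  shows "subspace (closure (coboundaries T))"
proof -
  have "linear (\<lambda>\<phi>. koopman T \<phi> - \<phi>)"
    using linear_compose_sub[OF linear_koopman[OF assms] linear_ident] .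
  then show ?thesis
    unfolding coboundaries_def by (intro subspace_closure linear_subspace_image subspace_UNIV)
qed

lemma koopman_closure_coboundaries:
  assumes T: "continuous_on UNIV T"
  shows "koopman T ` closure (coboundaries T) \<subseteq> closure (coboundaries T)"
proof -
  have "continuous_on UNIV (koopman T)"
  proof (rule lipschitz_on_continuous_on[of 1], rule lipschitz_onI)
    show "dist (koopman T \<phi>) (koopman T \<psi>) \<le> 1 * dist \<phi> \<psi>" for \<phi> \<psi>
      by (auto intro!: dist_bound simp: apply_koopman[OF T] dist_bounded)
  qed simp
  then have "koopman T ` closure (coboundaries T) \<subseteq> closure (koopman T ` coboundaries T)"
    by (rule continuous_image_closure_subset) simp
  moreover have "koopman T ` coboundaries T \<subseteq> coboundaries T"
    unfolding coboundaries_def by (auto simp: linear_diff[OF linear_koopman[OF T]])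
  ultimately show ?thesis using closure_mono by blast
qed

definition ergodic_measures :: "('a::topological_space \<Rightarrow> 'a) \<Rightarrow> 'a measure set" where
  "ergodic_measures T =
     {M. sets M = sets borel \<and> prob_space M \<and> distr M borel T = M \<and>
         (\<forall>A\<in>sets borel. T -` A = A \<longrightarrow> measure M A = 0 \<or> measure M A = 1)}"

end

(*
  The induced operator is the identity, because U f - f is a coboundary. So its multiplicity is the
  dimension of the quotient of C(X) by N, the closure of the coboundaries.

  Distinct ergodic measures are carried by disjoint invariant sets. So they give linearly independent
  functionals on C(X) / N, and the dimension is at least their number.

  Conversely, a function f outside N has Birkhoff averages that do not tend to 0 uniformly, so the
  sublinear functional p f = inf_g sup (f + g), g ranging over the coboundaries, is positive at f
  or at -f. A Hahn-Banach argument that keeps track of faces gives a linear functional below p which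
  attains p at that point and is extreme among those below p. By the Riesz representation theorem
  it is the integral against an invariant measure, and extremality makes that measure ergodic. Hence
  the ergodic integrals separate C(X) / N, and finitely many of them bound its dimension.
*)
theory Submission
  imports Defs
begin

subsection \<open>Extreme functionals below a sublinear functional\<close>

text \<open>Krein-Milman would need compactness of the set of invariant measures in a topology on
  the dual. Here a face of functionals is encoded by the sublinear functional that bounds it, so
  Zorn's lemma runs on real functions ordered pointwise; starting from \<open>pinch p v\<close>
  forces the extreme functional to take the value \<open>p v\<close> at the prescribed v.
  Metrizability enters through one consequence: each closed set is the zero set of a continuous h
  \<ge> 0. Then min 1 (n h) increases to the indicator of the open complement, which drives both the
  construction of the Riesz measure and the uniqueness arguments. Multiplicity is defined by dense
  spans, and the two inequalities meet this differently. For the lower bound, a combination of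
  ergodic integrals is continuous for the quotient norm, so its vanishing on generators passes to
  the closure of their span. For the upper bound, the span that is built is the entire quotient. The
  infinite case is reached through finite subfamilies of measures.\<close>

definition sublinear :: "('v::real_vector \<Rightarrow> real) \<Rightarrow> bool" where
  "sublinear q \<longleftrightarrow> (\<forall>x y. q (x + y) \<le> q x + q y) \<and> (\<forall>t x. 0 \<le> t \<longrightarrow> q (t *\<^sub>R x) = t * q x)"

lemma sublinear_add: "sublinear q \<Longrightarrow> q (x + y) \<le> q x + q y"
  and sublinear_scale: "sublinear q \<Longrightarrow> 0 \<le> t \<Longrightarrow> q (t *\<^sub>R x) = t * q x"
  by (auto simp: sublinear_def)

lemma sublinear_zero: "sublinear q \<Longrightarrow> q 0 = 0"
  using sublinear_scale[of q 0 0] by simp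

lemma sublinear_minus: "sublinear q \<Longrightarrow> - q (- x) \<le> q x"
  using sublinear_add[of q x "- x"] sublinear_zero[of q] by simp

text \<open>The largest sublinear functional below \<open>q\<close> whose value at \<open>- v\<close> is \<open>- q v\<close>.\<close>

definition pinch :: "('v::real_vector \<Rightarrow> real) \<Rightarrow> 'v \<Rightarrow> 'v \<Rightarrow> real" where
  "pinch q v x = (INF t\<in>{0..}. q (x + t *\<^sub>R v) - t * q v)"

lemma pinch_bdd:
  assumes "sublinear q"
  shows "bdd_below ((\<lambda>t. q (x + t *\<^sub>R v) - t * q v) ` {0..})"
proof (rule bdd_belowI2[of _ "- q (- x)"])
  fix t :: real assume "t \<in> {0..}"
  then show "- q (- x) \<le> q (x + t *\<^sub>R v) - t * q v"
    using sublinear_add[OF assms, of "x + t *\<^sub>R v" "- x"] sublinear_scale[OF assms, of t v] by simp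
qed

lemma pinch_le_at:
  assumes "sublinear q" "0 \<le> t"
  shows "pinch q v x \<le> q (x + t *\<^sub>R v) - t * q v"
  unfolding pinch_def using assms by (intro cINF_lower pinch_bdd) auto

lemma pinch_greatest: "(\<And>t. 0 \<le> t \<Longrightarrow> c \<le> q (x + t *\<^sub>R v) - t * q v) \<Longrightarrow> c \<le> pinch q v x"
  unfolding pinch_def by (intro cINF_greatest) auto

lemma pinch_le: "sublinear q \<Longrightarrow> pinch q v x \<le> q x"
  using pinch_le_at[of q 0 v x] by simp

lemma pinch_uminus: "sublinear q \<Longrightarrow> pinch q v (- v) \<le> - q v"
  using pinch_le_at[of q 1 v "- v"] sublinear_zero[of q] by simp

text \<open>Parameters add: s for x and t for y give the admissible parameter s + t for x + y. For
  scaling by t > 0 the parameter s becomes s / t, and the reverse inequality is the same one for 1 /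
  t.\<close>

lemma sublinear_pinch:
  assumes q: "sublinear q"
  shows "sublinear (pinch q v)"
  unfolding sublinear_def
proof (intro conjI allI impI)
  fix x y
  have "pinch q v (x + y) - (q (x + s *\<^sub>R v) - s * q v) \<le> pinch q v y" if s: "0 \<le> s" for s
  proof (rule pinch_greatest)
    fix t :: real assume t: "0 \<le> t"
    have "pinch q v (x + y) \<le> q ((x + y) + (s + t) *\<^sub>R v) - (s + t) * q v"
      using s t by (intro pinch_le_at q) auto
    also have "(x + y) + (s + t) *\<^sub>R v = (x + s *\<^sub>R v) + (y + t *\<^sub>R v)"
      by (simp add: algebra_simps)
    finally show "pinch q v (x + y) - (q (x + s *\<^sub>R v) - s * q v) \<le> q (y + t *\<^sub>R v) - t * q v"
      using sublinear_add[OF q, of "x + s *\<^sub>R v" "y + t *\<^sub>R v"] by (simp add: algebra_simps)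
  qed
  then have "pinch q v (x + y) - pinch q v y \<le> q (x + s *\<^sub>R v) - s * q v" if "0 \<le> s" for s
    using that by (simp add: algebra_simps)
  then have "pinch q v (x + y) - pinch q v y \<le> pinch q v x" by (intro pinch_greatest) auto
  then show "pinch q v (x + y) \<le> pinch q v x + pinch q v y" by simp
next
  have le: "t * pinch q v x \<le> pinch q v (t *\<^sub>R x)" if t: "0 < t" for t x
  proof (rule pinch_greatest)
    fix s :: real assume s: "0 \<le> s"
    have "t * pinch q v x \<le> t * (q (x + (s / t) *\<^sub>R v) - (s / t) * q v)"
      using s t by (intro mult_left_mono pinch_le_at q) auto
    also have "\<dots> = q (t *\<^sub>R (x + (s / t) *\<^sub>R v)) - s * q v"
      using t by (subst sublinear_scale[OF q]) (auto simp: algebra_simps)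
    also have "t *\<^sub>R (x + (s / t) *\<^sub>R v) = t *\<^sub>R x + s *\<^sub>R v"
      using t by (simp add: algebra_simps)
    finally show "t * pinch q v x \<le> q (t *\<^sub>R x + s *\<^sub>R v) - s * q v" .
  qed
  fix t :: real and x :: 'a assume t: "0 \<le> t"
  show "pinch q v (t *\<^sub>R x) = t * pinch q v x"
  proof (cases "t = 0")
    case True
    have "pinch q v 0 = 0"
    proof (rule antisym)
      show "pinch q v 0 \<le> 0" using pinch_le[OF q, of v 0] by (simp add: sublinear_zero[OF q])
      show "0 \<le> pinch q v 0"
        by (rule pinch_greatest) (simp add: sublinear_scale[OF q])
    qed
    then show ?thesis using True by simp
  next
    case False
    then have "pinch q v (t *\<^sub>R x) \<le> t * pinch q v x"
      using le[of "1 / t" "t *\<^sub>R x"] t by (simp add: field_simps)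
    then show ?thesis using le[of t x] t False by simp
  qed
qed

lemma linear_if_sublinear_odd:
  assumes q: "sublinear q" and odd: "\<And>x. q (- x) = - q x"
  shows "linear q"
proof (rule linearI)
  fix x y
  have "q ((x + y) + (- y)) \<le> q (x + y) + q (- y)" by (rule sublinear_add[OF q])
  then show "q (x + y) = q x + q y" using sublinear_add[OF q, of x y] odd[of y] by simp
next
  fix c x
  show "q (c *\<^sub>R x) = c *\<^sub>R q x"
  proof (cases "0 \<le> c")
    case False
    then have "q ((- c) *\<^sub>R x) = - c * q x" by (intro sublinear_scale[OF q]) auto
    then show ?thesis using odd[of "c *\<^sub>R x"] by simp
  qed (simp add: sublinear_scale[OF q])
qed

text \<open>
  The linear functionals below \<open>q\<close> form a face of those below \<open>p\<close>. The set of such \<open>q\<close> is closed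
  under \<^const>\<open>pinch\<close> and under infima of chains, and a minimal one is linear.
\<close>

definition face :: "('v::real_vector \<Rightarrow> real) \<Rightarrow> ('v \<Rightarrow> real) \<Rightarrow> bool" where
  "face p q \<longleftrightarrow> sublinear q \<and> q \<le> p \<and>
     (\<forall>L1 L2 s. linear L1 \<longrightarrow> linear L2 \<longrightarrow> L1 \<le> p \<longrightarrow> L2 \<le> p \<longrightarrow> 0 < s \<longrightarrow> s < 1 \<longrightarrow>
        (\<lambda>x. s * L1 x + (1 - s) * L2 x) \<le> q \<longrightarrow> L1 \<le> q \<and> L2 \<le> q)"

lemma faceD:
  "\<lbrakk>face p q; linear L1; linear L2; L1 \<le> p; L2 \<le> p; 0 < s; s < 1;
    (\<lambda>x. s * L1 x + (1 - s) * L2 x) \<le> q\<rbrakk> \<Longrightarrow> L1 \<le> q \<and> L2 \<le> q"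
  unfolding face_def by blast

text \<open>At - v the bound \<open>pinch q v (- v) \<le> - q v\<close> leaves no slack: a convex
  combination below it forces both L1 and L2 to agree with q at v. A linear functional below q with
  that value at v is below \<open>pinch q v\<close>.\<close>

lemma face_pinch:
  assumes f: "face p q"
  shows "face p (pinch q v)"
  unfolding face_def
proof (intro conjI allI impI)
  have q: "sublinear q" and qp: "q \<le> p" using f by (auto simp: face_def)
  show "sublinear (pinch q v)" by (rule sublinear_pinch[OF q])
  have pq: "pinch q v \<le> q" by (intro le_funI pinch_le q)
  then show "pinch q v \<le> p" using qp by (rule order_trans)
  fix L1 L2 :: "'a \<Rightarrow> real" and s :: real
  assume L: "linear L1" "linear L2" "L1 \<le> p" "L2 \<le> p" and s: "0 < s" "s < 1"
    and le: "(\<lambda>x. s * L1 x + (1 - s) * L2 x) \<le> pinch q v"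
  have Lq: "L1 \<le> q" "L2 \<le> q" using faceD[OF f L s order_trans[OF le pq]] by auto
  have "s * L1 (- v) + (1 - s) * L2 (- v) \<le> - q v"
    using le_funD[OF le, of "- v"] pinch_uminus[OF q, of v] by linarith
  then have "s * (q v - L1 v) + (1 - s) * (q v - L2 v) \<le> 0"
    using L by (simp add: linear_neg algebra_simps)
  moreover have "0 \<le> s * (q v - L1 v)" "0 \<le> (1 - s) * (q v - L2 v)"
    using Lq s by (auto simp: le_fun_def)
  ultimately have "s * (q v - L1 v) = 0" "(1 - s) * (q v - L2 v) = 0" by linarith+
  then have eq: "L1 v = q v" "L2 v = q v" using s by auto
  have "M \<le> pinch q v" if "linear M" "M v = q v" "M \<le> q" for M
  proof (intro le_funI pinch_greatest)
    fix x and t :: real assume "0 \<le> t"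
    show "M x \<le> q (x + t *\<^sub>R v) - t * q v"
      using le_funD[OF that(3), of "x + t *\<^sub>R v"] that by (simp add: linear_add linear_scale)
  qed
  then show "L1 \<le> pinch q v" "L2 \<le> pinch q v" using L eq Lq by auto
qed

text \<open>The bound \<open>- p (- x)\<close>, common to all members, keeps the pointwise infimum
  finite. Subadditivity uses the chain: two members evaluated at x and at y are both replaced by the
  smaller one.\<close>

lemma face_chain_INF:
  assumes ne: "C \<noteq> {}" and C: "\<And>q. q \<in> C \<Longrightarrow> face p q"
    and chain: "\<And>q r. q \<in> C \<Longrightarrow> r \<in> C \<Longrightarrow> q \<le> r \<or> r \<le> q"
  shows "face p (\<lambda>x. INF q\<in>C. q x)" and "\<And>q. q \<in> C \<Longrightarrow> (\<lambda>x. INF q\<in>C. q x) \<le> q"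
proof -
  define m where "m x = (INF q\<in>C. q x)" for x
  have sub: "sublinear q" and le_p: "q \<le> p" if "q \<in> C" for q using C[OF that] by (auto simp: face_def)
  have bdd: "bdd_below ((\<lambda>q. q x) ` C)" for x
  proof (rule bdd_belowI2[of _ "- p (- x)"])
    fix q assume "q \<in> C"
    then show "- p (- x) \<le> q x"
      using le_funD[OF le_p, of q "- x"] sublinear_minus[OF sub, of q x] by linarith
  qed
  have m_le: "m x \<le> q x" if "q \<in> C" for q x unfolding m_def using that bdd by (intro cINF_lower)
  have m_ge: "c \<le> m x" if "\<And>q. q \<in> C \<Longrightarrow> c \<le> q x" for c x
    unfolding m_def using that ne by (intro cINF_greatest)
  then show "\<And>q. q \<in> C \<Longrightarrow> (\<lambda>x. INF q\<in>C. q x) \<le> q" using m_le by (auto simp: le_fun_def m_def)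
  have "sublinear m" unfolding sublinear_def
  proof (intro conjI allI impI)
    fix x y
    have "m (x + y) - q x \<le> r y" if qr: "q \<in> C" "r \<in> C" for q r
    proof -
      obtain u where u: "u \<in> C" "u \<le> q" "u \<le> r" using chain[OF qr] qr by blast
      then have "m (x + y) \<le> u x + u y"
        using m_le[OF u(1), of "x + y"] sublinear_add[OF sub[OF u(1)], of x y] by linarith
      then show ?thesis using u le_funD[of u q x] le_funD[of u r y] by linarith
    qed
    then have "m (x + y) - q x \<le> m y" if "q \<in> C" for q using that by (intro m_ge) auto
    then have "m (x + y) - m y \<le> m x" by (intro m_ge) (simp add: algebra_simps)
    then show "m (x + y) \<le> m x + m y" by simp
  next
    have le: "t * m x \<le> m (t *\<^sub>R x)" if t: "0 \<le> t" for t x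
      using t by (intro m_ge) (simp add: sublinear_scale[OF sub] mult_left_mono m_le)
    fix t :: real and x assume t: "0 \<le> t"
    show "m (t *\<^sub>R x) = t * m x"
    proof (cases "t = 0")
      case True
      have "m 0 = 0" unfolding m_def using ne by (simp add: sublinear_zero[OF sub] cong: INF_cong)
      then show ?thesis using True by simp
    next
      case False
      then have "m (t *\<^sub>R x) \<le> t * m x" using le[of "1 / t" "t *\<^sub>R x"] t by (simp add: field_simps)
      then show ?thesis using le[OF t, of x] by simp
    qed
  qed
  moreover have "m \<le> p"
  proof -
    obtain q where "q \<in> C" using ne by blast
    then show ?thesis using m_le[of q] le_funD[OF le_p] by (intro le_funI) (meson order_trans)
  qed
  moreover have "L1 \<le> m \<and> L2 \<le> m"
    if L: "linear L1" "linear L2" "L1 \<le> p" "L2 \<le> p" "0 < s" "s < 1"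
      "(\<lambda>x. s * L1 x + (1 - s) * L2 x) \<le> m" for L1 L2 s
  proof -
    have "L1 \<le> q \<and> L2 \<le> q" if q: "q \<in> C" for q
    proof (rule faceD[OF C[OF q]])
      show "(\<lambda>x. s * L1 x + (1 - s) * L2 x) \<le> q"
        using order_trans[OF \<open>_ \<le> m\<close>, of q] m_le[OF q] by (auto simp: le_fun_def)
    qed (use L in auto)
    then show ?thesis by (auto intro!: le_funI m_ge simp: le_fun_def)
  qed
  ultimately show "face p (\<lambda>x. INF q\<in>C. q x)" unfolding face_def m_def[symmetric] by auto
qed

theorem extreme_dominated_functional:
  fixes p :: "'v::real_vector \<Rightarrow> real"
  assumes p: "sublinear p"
  obtains L where "linear L" "L \<le> p" "L v = p v"
    "\<And>L1 L2 s. \<lbrakk>linear L1; linear L2; L1 \<le> p; L2 \<le> p; 0 < s; s < 1;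
       \<And>x. L x = s * L1 x + (1 - s) * L2 x\<rbrakk> \<Longrightarrow> L1 = L"
proof -
  define A where "A = {q. face p q \<and> q \<le> pinch p v}"
  have p0: "pinch p v \<in> A" unfolding A_def using face_pinch[of p p v] p by (auto simp: face_def)
  \<comment> \<open>Zorn's lemma for the reversed order: chains need lower bounds, and the element
    obtained is minimal.\<close>
  have "\<exists>m\<in>A. \<forall>q\<in>A. m \<ge> q \<longrightarrow> q = m"
  proof (rule predicate_Zorn)
    show "partial_order_on A (relation_of (\<ge>) A)"
      by (auto simp: partial_order_on_def preorder_on_def refl_on_def trans_def antisym_def relation_of_def)
  next
    fix C assume C: "C \<in> Chains (relation_of (\<ge>) A)"
    show "\<exists>u\<in>A. \<forall>a\<in>C. u \<le> a"
    proof (cases "C = {}")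
      case True
      then show ?thesis using p0 by auto
    next
      case False
      have CA: "C \<subseteq> A" using C by (auto simp: Chains_def relation_of_def)
      have ch: "q \<le> r \<or> r \<le> q" if "q \<in> C" "r \<in> C" for q r
        using C that by (auto simp: Chains_def relation_of_def)
      have fc: "face p q" if "q \<in> C" for q using CA that by (auto simp: A_def)
      have INF1: "face p (\<lambda>x. INF q\<in>C. q x)"
        using False by (rule face_chain_INF(1)) (use fc ch in auto)
      have INF2: "(\<lambda>x. INF q\<in>C. q x) \<le> q" if "q \<in> C" for q
        using False by (rule face_chain_INF(2)) (use fc ch that in auto)
      obtain q where q: "q \<in> C" using False by blast
      have "(\<lambda>x. INF q\<in>C. q x) \<le> pinch p v"
        using order_trans[OF INF2[OF q]] CA q by (auto simp: A_def)
      then have "(\<lambda>x. INF q\<in>C. q x) \<in> A" using INF1 by (simp add: A_def)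
      then show ?thesis using INF2 by blast
    qed
  qed
  then obtain m where mA: "m \<in> A" and min: "\<And>q. q \<in> A \<Longrightarrow> q \<le> m \<Longrightarrow> q = m" by blast
  have f: "face p m" and mv: "m \<le> pinch p v" using mA by (auto simp: A_def)
  have m: "sublinear m" and mp: "m \<le> p" using f by (auto simp: face_def)
  \<comment> \<open>Pinching m at x stays in A and below m, so minimality gives
    \<open>pinch m x = m\<close>; the value at - x then yields oddness.\<close>
  have "m (- x) = - m x" for x
  proof -
    have "pinch m x \<le> m" by (intro le_funI pinch_le m)
    then have "pinch m x = m"
      using min[of "pinch m x"] face_pinch[OF f] mv by (auto simp: A_def)
    then have "m (- x) \<le> - m x" using pinch_uminus[OF m, of x] by simp
    then show ?thesis using sublinear_minus[OF m, of x] by linarith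
  qed
  then have lin: "linear m" using m by (intro linear_if_sublinear_odd)
  \<comment> \<open>Between linear functionals domination is equality, by evaluation at x and - x.
    This turns the face property of m into extremality.\<close>
  have eqI: "L1 = m" if "linear L1" "L1 \<le> m" for L1
  proof
    fix x show "L1 x = m x"
      using le_funD[OF that(2), of x] le_funD[OF that(2), of "- x"] linear_neg[OF that(1), of x]
        linear_neg[OF lin, of x] by simp
  qed
  show thesis
  proof (rule that[OF lin mp])
    show "m v = p v"
      using le_funD[OF mv, of "- v"] pinch_uminus[OF p, of v] linear_neg[OF lin, of v]
        le_funD[OF mp, of v] by simp
    show "L1 = m" if "linear L1" "linear L2" "L1 \<le> p" "L2 \<le> p" "0 < s" "s < 1"
      "\<And>x. m x = s * L1 x + (1 - s) * L2 x" for L1 L2 s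
      using faceD[OF f that(1-6)] that(1,7) by (intro eqI) (auto simp: le_fun_def)
  qed
qed

subsection \<open>Finite families of linear functionals\<close>

text \<open>Gaussian elimination: an equation with nonzero coefficient at k removes the unknown k.
  Applied later to get a nonzero combination of ergodic integrals vanishing on fewer generators than
  there are measures.\<close>

lemma homogeneous_system_solution:
  fixes a :: "'f \<Rightarrow> 'i \<Rightarrow> real"
  assumes "finite F" "finite I" "card F < card I"
  shows "\<exists>c. (\<exists>i\<in>I. c i \<noteq> 0) \<and> (\<forall>f\<in>F. (\<Sum>i\<in>I. c i * a f i) = 0)"
  using assms
proof (induction F arbitrary: a I rule: finite_induct)
  case empty
  then have "I \<noteq> {}" by auto
  then show ?case by (intro exI[of _ "\<lambda>_. 1"]) auto
next
  case (insert g F)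
  show ?case
  proof (cases "\<forall>i\<in>I. a g i = 0")
    case True
    have "card F < card I" using insert by simp
    then obtain c where "\<exists>i\<in>I. c i \<noteq> 0" "\<forall>f\<in>F. (\<Sum>i\<in>I. c i * a f i) = 0"
      using insert.IH[of I a] insert.prems by blast
    then show ?thesis using True by (intro exI[of _ c]) auto
  next
    case False
    then obtain k where k: "k \<in> I" "a g k \<noteq> 0" by blast
    define b where "b f i = a f i - a f k * a g i / a g k" for f i
    have "card F < card (I - {k})" using insert k by simp
    then obtain c where c: "\<exists>i\<in>I - {k}. c i \<noteq> 0" "\<forall>f\<in>F. (\<Sum>i\<in>I - {k}. c i * b f i) = 0"
      using insert.IH[of "I - {k}" b] insert.prems by blast
    \<comment> \<open>The value - r of the eliminated unknown is the one forced by the equation of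
      g.\<close>
    define r where "r = (\<Sum>i\<in>I - {k}. c i * a g i) / a g k"
    define d where "d = c(k := - r)"
    have d: "(\<Sum>i\<in>I. d i * a f i) = - r * a f k + (\<Sum>i\<in>I - {k}. c i * a f i)" for f
      using k insert.prems by (subst sum.remove[of I k]) (auto simp: d_def intro!: sum.cong)
    have "(\<Sum>i\<in>I. d i * a f i) = 0" if "f \<in> insert g F" for f
    proof (cases "f = g")
      case True
      then show ?thesis using k by (simp add: d r_def)
    next
      case False
      then have "0 = (\<Sum>i\<in>I - {k}. c i * b f i)" using that c by auto
      also have "\<dots> = (\<Sum>i\<in>I - {k}. c i * a f i - a f k / a g k * (c i * a g i))"
        by (intro sum.cong) (auto simp: b_def algebra_simps)
      also have "\<dots> = (\<Sum>i\<in>I - {k}. c i * a f i) - r * a f k"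
        by (simp add: sum_subtractf r_def mult.commute flip: sum_distrib_left sum_divide_distrib)
      finally show ?thesis by (simp add: d)
    qed
    moreover have "\<exists>i\<in>I. d i \<noteq> 0" using c(1) by (auto simp: d_def)
    ultimately show ?thesis by blast
  qed
qed

text \<open>Every value of the joint evaluation map is reached on the span of F. A new functional
  either vanishes on the common kernel of the old ones, so F still suffices, or some u in that
  kernel corrects its value without disturbing the others.\<close>

lemma finite_functionals_span:
  fixes \<Lambda> :: "'i \<Rightarrow> 'v::real_vector \<Rightarrow> real"
  assumes "finite I" "\<And>i. i \<in> I \<Longrightarrow> linear (\<Lambda> i)"
  shows "\<exists>F. finite F \<and> card F \<le> card I \<and> (\<forall>v. \<exists>w\<in>span F. \<forall>i\<in>I. \<Lambda> i w = \<Lambda> i v)"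
  using assms
proof (induction I rule: finite_induct)
  case empty
  show ?case by (intro exI[of _ "{}"]) auto
next
  case (insert j I)
  then obtain F where F: "finite F" "card F \<le> card I"
    "\<And>v. \<exists>w\<in>span F. \<forall>i\<in>I. \<Lambda> i w = \<Lambda> i v" by auto
  have lin: "linear (\<Lambda> i)" if "i \<in> insert j I" for i using insert.prems that by auto
  show ?case
  proof (cases "\<forall>u. (\<forall>i\<in>I. \<Lambda> i u = 0) \<longrightarrow> \<Lambda> j u = 0")
    case True
    have "\<exists>w\<in>span F. \<forall>i\<in>insert j I. \<Lambda> i w = \<Lambda> i v" for v
    proof -
      obtain w where w: "w \<in> span F" "\<forall>i\<in>I. \<Lambda> i w = \<Lambda> i v" using F(3) by blast
      then have "\<forall>i\<in>I. \<Lambda> i (w - v) = 0" using lin by (simp add: linear_diff)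
      then have "\<Lambda> j (w - v) = 0" using True by blast
      then show ?thesis using w lin by (intro bexI[of _ w]) (auto simp: linear_diff)
    qed
    then show ?thesis using F insert.hyps by (intro exI[of _ F]) auto
  next
    case False
    then obtain u where u: "\<forall>i\<in>I. \<Lambda> i u = 0" "\<Lambda> j u \<noteq> 0" by blast
    have "\<exists>w\<in>span (insert u F). \<forall>i\<in>insert j I. \<Lambda> i w = \<Lambda> i v" for v
    proof -
      obtain w where w: "w \<in> span F" "\<forall>i\<in>I. \<Lambda> i w = \<Lambda> i v" using F(3) by blast
      define t where "t = (\<Lambda> j v - \<Lambda> j w) / \<Lambda> j u"
      have "w \<in> span (insert u F)" using w(1) span_mono[of F "insert u F"] by auto
      then have "w + t *\<^sub>R u \<in> span (insert u F)"
        by (intro span_add span_scale) (auto intro: span_base)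
      moreover have "\<Lambda> i (w + t *\<^sub>R u) = \<Lambda> i v" if "i \<in> insert j I" for i
        using that u w lin by (auto simp: linear_add linear_scale t_def)
      ultimately show ?thesis by blast
    qed
    moreover have "card (insert u F) \<le> card (insert j I)"
      using F insert.hyps by (simp add: card_insert_if)
    ultimately show ?thesis using F(1) by (intro exI[of _ "insert u F"]) auto
  qed
qed

subsection \<open>Continuous functions and measures on a compact metrizable space\<close>

text \<open>The distance to a nonempty C works. The metric is extracted from metrizability of the
  topology, the type itself carrying none, so continuity is checked on its balls.\<close>

lemma metrizable_closed_zero_set:
  fixes C :: "'a::topological_space set"
  assumes "metrizable_space (euclidean :: 'a topology)" "closed C"
  obtains h :: "'a \<Rightarrow> real" where "continuous_on UNIV h" "\<And>x. 0 \<le> h x" "C = {x. h x = 0}"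
proof (cases "C = {}")
  case True
  show thesis by (rule that[of "\<lambda>_. 1"]) (use True in auto)
next
  case False
  obtain M d where M: "Metric_space M d" and eq: "(euclidean :: 'a topology) = Metric_space.mtopology M d"
    using assms(1) unfolding metrizable_space_def by blast
  interpret Metric_space M d by fact
  have [simp]: "x \<in> M" for x using eq topspace_mtopology by (metis topspace_euclidean UNIV_I)
  have op: "open U \<longleftrightarrow> (\<forall>x\<in>U. \<exists>r>0. mball x r \<subseteq> U)" for U :: "'a set"
    using openin_mtopology[of U] unfolding eq[symmetric] by (simp add: Ball_def subset_iff)
  define h where "h x = (INF c\<in>C. d x c)" for x
  have bdd: "bdd_below (d x ` C)" for x by (rule bdd_belowI2[of _ 0]) simp
  have h_le: "h x \<le> d x c" if "c \<in> C" for x c unfolding h_def using bdd that by (intro cINF_lower)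
  have h_ge: "0 \<le> h x" for x unfolding h_def using False by (intro cINF_greatest) auto
  have lip: "h x - d x y \<le> h y" for x y
    unfolding h_def[of y]
  proof (rule cINF_greatest[OF False])
    fix c assume "c \<in> C"
    then show "h x - d x y \<le> d y c" using h_le[of c x] triangle[of x y c] by simp
  qed
  have "continuous_on UNIV h"
    unfolding continuous_on_open_vimage[OF open_UNIV]
  proof (intro allI impI)
    fix B :: "real set" assume B: "open B"
    have "\<exists>r>0. mball x r \<subseteq> h -` B" if "h x \<in> B" for x
    proof -
      obtain e where e: "0 < e" "ball (h x) e \<subseteq> B" using B \<open>h x \<in> B\<close> open_contains_ball by blast
      have "h y \<in> B" if "y \<in> mball x e" for y
      proof -
        have "\<bar>h x - h y\<bar> < e" using that lip[of x y] lip[of y x] commute[of x y] by simp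
        then show ?thesis using e(2) by (auto simp: dist_real_def)
      qed
      then show ?thesis using e(1) by auto
    qed
    then show "open (h -` B \<inter> UNIV)" by (auto simp: op)
  qed
  moreover have "C = {x. h x = 0}"
  proof (intro set_eqI iffI)
    fix x assume "x \<in> C"
    then show "x \<in> {x. h x = 0}" using h_le[of x x] h_ge[of x] by simp
  next
    fix x assume x: "x \<in> {x. h x = 0}"
    show "x \<in> C"
    proof (rule ccontr)
      assume "x \<notin> C"
      then obtain r where r: "0 < r" "mball x r \<subseteq> - C" using assms(2) op[of "- C"] by (auto simp: closed_def)
      have "r \<le> d x c" if "c \<in> C" for c using r(2) that by (force simp: subset_iff not_less[symmetric])
      then have "r \<le> h x" unfolding h_def using False by (intro cINF_greatest)
      then show False using x r by simp
    qed
  qed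
  ultimately show thesis using h_ge that by blast
qed

text \<open>Used at t = h x, where h \<ge> 0 is continuous and vanishes exactly off an open set U:
  the limit is then the indicator of U.\<close>

lemma tendsto_scaled_truncation:
  fixes t :: real
  assumes "0 \<le> t"
  shows "(\<lambda>n. min 1 (real n * t)) \<longlonglongrightarrow> indicator {0<..} t"
proof (cases "t = 0")
  case False
  then have t: "0 < t" using assms by simp
  have "eventually (\<lambda>n. 1 / t \<le> real n) sequentially"
    using filterlim_real_sequentially by (auto simp: filterlim_at_top)
  then have "eventually (\<lambda>n. min 1 (real n * t) = indicator {0<..} t) sequentially"
    by eventually_elim (use t in \<open>simp add: field_simps min_def\<close>)
  then show ?thesis by (rule tendsto_eventually)
qed simp

context
  assumes compact_UNIV: "compact (UNIV :: 'a::topological_space set)"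
    and zero_set: "\<And>C :: 'a set. closed C \<Longrightarrow>
      \<exists>h. continuous_on UNIV h \<and> (\<forall>x. (0::real) \<le> h x) \<and> C = {x. h x = 0}"
begin

lemma continuous_bcontfun:
  fixes f :: "'a \<Rightarrow> real"
  assumes "continuous_on UNIV f"
  shows "f \<in> bcontfun"
  using compact_continuous_image[OF assms compact_UNIV] assms
  by (simp add: bcontfun_def compact_imp_bounded)

lemma apply_Bcontfun: "continuous_on UNIV f \<Longrightarrow> apply_bcontfun (Bcontfun f) x = (f x :: real)" for f :: "'a \<Rightarrow> real"
  by (simp add: Bcontfun_inverse continuous_bcontfun)

text \<open>By compactness finitely many of the open sets where \<open>f n\<close> is below e cover
  the space; they grow with n, so the largest index serves at every point.\<close>

lemma Dini_less:
  fixes f :: "nat \<Rightarrow> 'a \<Rightarrow> real"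
  assumes cont: "\<And>n. continuous_on UNIV (f n)"
    and dec: "\<And>m n x. m \<le> n \<Longrightarrow> f n x \<le> f m x"
    and ex: "\<And>x. \<exists>n. f n x < e"
  shows "\<exists>n. \<forall>x. f n x < e"
proof -
  have "open {x. f n x < e}" for n
    using open_Collect_less[OF cont[of n] continuous_on_const] .
  moreover have "UNIV \<subseteq> (\<Union>n\<in>UNIV. {x. f n x < e})" using ex by auto
  ultimately obtain K where K: "finite K" "UNIV \<subseteq> (\<Union>n\<in>K. {x. f n x < e})"
    using compactE_image[OF compact_UNIV, of UNIV "\<lambda>n. {x. f n x < e}"] by metis
  have "f (Max K) x < e" for x
  proof -
    obtain n where "n \<in> K" "f n x < e" using K(2) by blast
    then show ?thesis using dec[of n "Max K" x] K(1) by (meson Max_ge order_le_less_trans)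
  qed
  then show ?thesis by blast
qed

text \<open>Dominated convergence along the truncations min 1 (n h) settles open sets, and the
  pi-lambda theorem extends this to Borel sets. Stated for signed combinations so as to serve three
  times: for equality of two measures, for independence of ergodic measures, and for a comparison of
  a measure with a multiple of another.\<close>

lemma signed_measure_zero:
  fixes M :: "'i \<Rightarrow> 'a measure"
  assumes fin: "finite I" and sets: "\<And>i. i \<in> I \<Longrightarrow> sets (M i) = sets borel"
    and fm: "\<And>i. i \<in> I \<Longrightarrow> finite_measure (M i)"
    and zero: "\<And>f. continuous_on UNIV f \<Longrightarrow> (\<Sum>i\<in>I. c i * (\<integral>x. f x \<partial>M i)) = (0::real)"
    and A: "A \<in> sets borel"
  shows "(\<Sum>i\<in>I. c i * measure (M i) A) = 0"
proof -
  have sp: "space (M i) = UNIV" if "i \<in> I" for i using sets_eq_imp_space_eq[OF sets[OF that]] by simp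
  have opens: "(\<Sum>i\<in>I. c i * measure (M i) U) = 0" if "open U" for U
  proof -
    obtain h :: "'a \<Rightarrow> real" where h: "continuous_on UNIV h" "\<And>x. 0 \<le> h x" "- U = {x. h x = 0}"
      using zero_set[of "- U"] \<open>open U\<close> unfolding closed_def double_complement by blast
    have U: "indicator {0<..} (h x) = (indicator U x :: real)" for x
      using h(2)[of x] h(3) by (auto simp: indicator_def set_eq_iff less_le)
    define g where "g n x = min 1 (real n * h x)" for n x
    have g: "continuous_on UNIV (g n)" for n
      unfolding g_def by (intro continuous_intros h)
    have "(\<lambda>n. \<integral>x. g n x \<partial>M i) \<longlonglongrightarrow> measure (M i) U" if i: "i \<in> I" for i
    proof -
      interpret finite_measure "M i" by (rule fm[OF i])
      have [measurable_cong]: "sets (M i) = sets borel" by (rule sets[OF i])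
      have "(\<lambda>n. \<integral>x. g n x \<partial>M i) \<longlonglongrightarrow> (\<integral>x. indicator U x \<partial>M i)"
      proof (rule integral_dominated_convergence[where w = "\<lambda>_. 1"])
        show "AE x in M i. (\<lambda>n. g n x) \<longlonglongrightarrow> indicator U x"
          unfolding g_def using tendsto_scaled_truncation[OF h(2)] by (simp add: U)
        show "AE x in M i. norm (g n x) \<le> 1" for n
          using h(2) by (auto simp: g_def min_def)
        show "g n \<in> borel_measurable (M i)" for n
          using borel_measurable_continuous_onI[OF g] by (simp add: measurable_cong_sets[OF sets[OF i] refl])
        show "(indicator U :: 'a \<Rightarrow> real) \<in> borel_measurable (M i)"
          using \<open>open U\<close> by (intro borel_measurable_indicator) (simp add: sets[OF i])
      qed simp
      then show ?thesis using \<open>open U\<close> by (simp add: sets[OF i] sp[OF i])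
    qed
    then have "(\<lambda>n. \<Sum>i\<in>I. c i * (\<integral>x. g n x \<partial>M i)) \<longlonglongrightarrow> (\<Sum>i\<in>I. c i * measure (M i) U)"
      by (intro tendsto_sum tendsto_mult tendsto_const) auto
    then show ?thesis using zero[OF g] by (simp add: LIMSEQ_const_iff)
  qed
  have "Int_stable {S :: 'a set. open S}" by (auto simp: Int_stable_def)
  moreover have "{S. open S} \<subseteq> Pow (UNIV :: 'a set)" by simp
  moreover have "A \<in> sigma_sets UNIV {S. open S}" using A by (simp add: borel_def)
  ultimately show ?thesis
  proof (induction rule: sigma_sets_induct_disjoint)
    case (basic B)
    then show ?case using opens by simp
  next
    case empty
    show ?case by simp
  next
    case (compl B)
    then have "B \<in> sets borel" by (simp add: borel_def)
    then have "(\<Sum>i\<in>I. c i * measure (M i) (UNIV - B)) = (\<Sum>i\<in>I. c i * measure (M i) UNIV - c i * measure (M i) B)"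
      using finite_measure.finite_measure_compl[OF fm, of _ B] sets sp
      by (intro sum.cong) (simp_all add: right_diff_distrib)
    then show ?case using compl opens[of UNIV] by (simp add: sum_subtractf)
  next
    case (union B)
    have "range B \<subseteq> sets borel" using union(2) by (simp add: borel_def)
    then have "(\<lambda>n. \<Sum>i\<in>I. c i * measure (M i) (B n)) sums (\<Sum>i\<in>I. c i * measure (M i) (\<Union>n. B n))"
      using union(1) sets
      by (intro sums_sum sums_mult finite_measure.finite_measure_UNION[OF fm]) auto
    moreover have "(\<lambda>n. \<Sum>i\<in>I. c i * measure (M i) (B n)) sums 0" using union(3) by simp
    ultimately show ?case by (rule sums_unique2)
  qed
qed

lemma measure_eqI_continuous:
  fixes M N :: "'a measure"
  assumes "finite_measure M" "finite_measure N" "sets M = sets borel" "sets N = sets borel"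
    and eq: "\<And>f. continuous_on UNIV f \<Longrightarrow> (\<integral>x. f x \<partial>M) = (\<integral>x. f x \<partial>N :: real)"
  shows "M = N"
proof (rule measure_eqI)
  fix A assume "A \<in> sets M"
  \<comment> \<open>The index type is bool: True stands for M with coefficient 1, False for N with
    coefficient - 1.\<close>
  then have "(\<Sum>i\<in>UNIV. (if i then 1 else - 1) * measure (if i then M else N) A) = 0"
    using assms by (intro signed_measure_zero) (auto simp: UNIV_bool)
  then show "emeasure M A = emeasure N A"
    using assms by (simp add: UNIV_bool finite_measure.emeasure_eq_measure)
qed (simp add: assms)

end

subsection \<open>The Riesz representation theorem\<close>

text \<open>The sum counts the integers j with 1 \<le> j \<le> n and j < y. At y = n f(x) it
  discretizes f to accuracy 1 / n.\<close>

lemma sum_threshold_bounds: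
  fixes y :: real
  assumes "0 \<le> y"
  shows "min (real n) (y - 1) \<le> (\<Sum>i<n. if real i + 1 < y then 1 else 0)
    \<and> (\<Sum>i<n. if real i + 1 < y then 1 else 0) \<le> min (real n) y"
  using assms by (induction n) (auto simp: min_def split: if_splits)

context
  fixes \<Lambda> :: "('a::topological_space \<Rightarrow> real) \<Rightarrow> real"
  assumes compact_UNIV: "compact (UNIV :: 'a set)"
    and zero_set: "\<And>C :: 'a set. closed C \<Longrightarrow>
      \<exists>h. continuous_on UNIV h \<and> (\<forall>x. (0::real) \<le> h x) \<and> C = {x. h x = 0}"
    and \<Lambda>_add: "\<And>f g. continuous_on UNIV f \<Longrightarrow> continuous_on UNIV g \<Longrightarrow> \<Lambda> (\<lambda>x. f x + g x) = \<Lambda> f + \<Lambda> g"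
    and \<Lambda>_scale: "\<And>f c. continuous_on UNIV f \<Longrightarrow> \<Lambda> (\<lambda>x. c * f x) = c * \<Lambda> f"
    and \<Lambda>_nonneg: "\<And>f. continuous_on UNIV f \<Longrightarrow> (\<And>x. 0 \<le> f x) \<Longrightarrow> 0 \<le> \<Lambda> f"
    and \<Lambda>_one: "\<Lambda> (\<lambda>_. 1) = 1"
begin

lemma \<Lambda>_const: "\<Lambda> (\<lambda>_. c) = c"
  using \<Lambda>_scale[of "\<lambda>_. 1" c] by (simp add: \<Lambda>_one)

lemma \<Lambda>_mono:
  assumes "continuous_on UNIV f" "continuous_on UNIV g" "\<And>x. f x \<le> g x"
  shows "\<Lambda> f \<le> \<Lambda> g"
proof -
  have "0 \<le> \<Lambda> (\<lambda>x. g x + (- 1) * f x)"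
    using assms by (intro \<Lambda>_nonneg continuous_intros) auto
  also have "\<dots> = \<Lambda> g + \<Lambda> (\<lambda>x. (- 1) * f x)"
    using assms by (intro \<Lambda>_add continuous_intros) auto
  also have "\<Lambda> (\<lambda>x. (- 1) * f x) = - \<Lambda> f"
    using assms by (subst \<Lambda>_scale) auto
  finally show ?thesis by simp
qed

lemma \<Lambda>_sum:
  assumes "\<And>i. continuous_on UNIV (f i)"
  shows "\<Lambda> (\<lambda>x. \<Sum>i<n. f i x) = (\<Sum>i<n::nat. \<Lambda> (f i))"
  by (induction n) (auto simp: \<Lambda>_const assms \<Lambda>_add continuous_on_sum)

text \<open>Competitors vanish off U, but their support may touch the boundary of U. The usual work
  of compact supports inside U is done by Dini's theorem in
  \<open>open_mass_countable_subadditive\<close> and by the truncation max 0 (f - e) in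
  \<open>outer_mass_split_open\<close>.\<close>

definition below :: "'a set \<Rightarrow> ('a \<Rightarrow> real) \<Rightarrow> bool" where
  "below U f \<longleftrightarrow> continuous_on UNIV f \<and> (\<forall>x. 0 \<le> f x) \<and> (\<forall>x. f x \<le> indicator U x)"

definition open_mass :: "'a set \<Rightarrow> ennreal" where
  "open_mass U = (SUP f\<in>{f. below U f}. ennreal (\<Lambda> f))"

definition outer_mass :: "'a set \<Rightarrow> ennreal" where
  "outer_mass A = (INF U\<in>{U. open U \<and> A \<subseteq> U}. open_mass U)"

lemma below_nonneg: "below U f \<Longrightarrow> 0 \<le> \<Lambda> f"
  by (auto simp: below_def intro: \<Lambda>_nonneg)

lemma below_zero: "below U (\<lambda>_. 0)"
  by (simp add: below_def)

lemma open_mass_ge: "below U f \<Longrightarrow> ennreal (\<Lambda> f) \<le> open_mass U"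
  unfolding open_mass_def by (rule SUP_upper) simp

lemma open_mass_mono: "U \<subseteq> V \<Longrightarrow> open_mass U \<le> open_mass V"
  unfolding open_mass_def below_def
  by (rule SUP_subset_mono) (auto intro: order_trans[OF _ indicator_leI])

lemma open_mass_empty: "open_mass {} = 0"
proof -
  have "f = (\<lambda>_. 0)" if "below {} f" for f
    using that by (auto simp: below_def fun_eq_iff antisym)
  then have "{f. below {} f} = {\<lambda>_. 0}" using below_zero by auto
  then show ?thesis by (simp add: open_mass_def \<Lambda>_const)
qed

lemma open_mass_UNIV: "open_mass UNIV = 1"
proof (rule antisym)
  show "open_mass UNIV \<le> 1"
    unfolding open_mass_def
  proof (rule SUP_least)
    fix f assume "f \<in> {f. below UNIV f}"
    then have "\<Lambda> f \<le> \<Lambda> (\<lambda>_. 1)" by (intro \<Lambda>_mono) (auto simp: below_def)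
    then show "ennreal (\<Lambda> f) \<le> 1" by (simp add: \<Lambda>_one)
  qed
  show "1 \<le> open_mass UNIV"
    using open_mass_ge[of UNIV "\<lambda>_. 1"] by (simp add: below_def \<Lambda>_one)
qed

lemma outer_mass_open: "open U \<Longrightarrow> outer_mass U = open_mass U"
  unfolding outer_mass_def
  by (rule antisym) (auto intro!: INF_lower INF_greatest open_mass_mono)

lemma outer_mass_le: "open U \<Longrightarrow> A \<subseteq> U \<Longrightarrow> outer_mass A \<le> open_mass U"
  unfolding outer_mass_def by (rule INF_lower) simp

text \<open>Truncations rising to the indicators of the U i exhaust f up to e, uniformly by Dini, so
  finitely many sets carry f. Their masses bound \<Lambda> f, and the constant e costs only e
  because \<Lambda> is normalized.\<close>

lemma open_mass_countable_subadditive: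
  assumes U: "\<And>n::nat. open (U n)"
  shows "open_mass (\<Union>n. U n) \<le> (\<Sum>n. open_mass (U n))"
  unfolding open_mass_def[of "\<Union>n. U n"]
proof (rule SUP_least)
  fix f assume "f \<in> {f. below (\<Union>n. U n) f}"
  then have f: "continuous_on UNIV f" "\<And>x. f x \<le> indicator (\<Union>n. U n) x"
    by (auto simp: below_def)
  obtain h where h: "\<And>n. continuous_on UNIV (h n)" "\<And>n x. (0::real) \<le> h n x" "\<And>n. - U n = {x. h n x = 0}"
    using zero_set[of "- U _"] U unfolding closed_def double_complement by metis
  \<comment> \<open>In the sums below one n governs both the sharpness of the truncations and the
    number of sets, which gives a single monotone sequence for Dini.\<close>
  define g where "g n i x = min 1 (real n * h i x)" for n i x
  have g_cont: "continuous_on UNIV (g n i)" for n i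
    unfolding g_def by (intro continuous_intros h)
  have g_nonneg: "0 \<le> g n i x" for n i x using h(2) by (simp add: g_def)
  have g_below: "below (U i) (g n i)" for n i
    unfolding below_def using g_cont g_nonneg h(3)[of i]
    by (auto simp: g_def indicator_def set_eq_iff)
  show "ennreal (\<Lambda> f) \<le> (\<Sum>n. open_mass (U n))"
  proof (rule ennreal_le_epsilon)
    fix e :: real assume e: "0 < e"
    have "\<exists>n. \<forall>x. f x - (\<Sum>i<n. g n i x) < e"
    proof (rule Dini_less[OF compact_UNIV zero_set])
      show "continuous_on UNIV (\<lambda>x. f x - (\<Sum>i<n. g n i x))" for n
        by (intro continuous_intros f g_cont)
      show "f x - (\<Sum>i<n. g n i x) \<le> f x - (\<Sum>i<m. g m i x)" if "m \<le> n" for m n x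
      proof -
        have "(\<Sum>i<m. g m i x) \<le> (\<Sum>i<m. g n i x)"
          unfolding g_def using that h(2) by (intro sum_mono min.mono mult_right_mono) auto
        also have "\<dots> \<le> (\<Sum>i<n. g n i x)"
          using that g_nonneg by (intro sum_mono2) auto
        finally show ?thesis by simp
      qed
      show "\<exists>n. f x - (\<Sum>i<n. g n i x) < e" for x
      proof (cases "x \<in> (\<Union>n. U n)")
        case True
        then obtain i where i: "x \<in> U i" by blast
        then have pos: "0 < h i x" using h(2)[of i x] h(3)[of i] by (auto simp: set_eq_iff less_le)
        obtain k where k: "1 / h i x \<le> real k" using real_arch_simple by blast
        \<comment> \<open>k makes the truncation at x equal to 1, and Suc i puts the index i among
          the summands.\<close>
        define n where "n = max k (Suc i)"
        have "1 \<le> real k * h i x" using k pos by (simp add: field_simps)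
        also have "\<dots> \<le> real n * h i x" using pos by (simp add: n_def)
        finally have "1 = g n i x" by (simp add: g_def)
        also have "\<dots> \<le> (\<Sum>i<n. g n i x)"
          using g_nonneg by (intro member_le_sum) (auto simp: n_def)
        finally show ?thesis using f(2)[of x] True e by (intro exI[of _ n]) auto
      next
        case False
        then show ?thesis using f(2)[of x] e by (intro exI[of _ 0]) auto
      qed
    qed
    then obtain n where n: "\<And>x. f x - (\<Sum>i<n. g n i x) < e" by blast
    have "\<Lambda> f \<le> \<Lambda> (\<lambda>x. (\<Sum>i<n. g n i x) + e)"
      using n by (intro \<Lambda>_mono f continuous_intros g_cont) (simp add: algebra_simps less_imp_le)
    also have "\<dots> = (\<Sum>i<n. \<Lambda> (g n i)) + e"
      by (subst \<Lambda>_add) (auto simp: \<Lambda>_const \<Lambda>_sum g_cont intro!: continuous_intros)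
    finally have "ennreal (\<Lambda> f) \<le> ennreal ((\<Sum>i<n. \<Lambda> (g n i)) + e)" by (rule ennreal_leI)
    also have "\<dots> = (\<Sum>i<n. ennreal (\<Lambda> (g n i))) + ennreal e"
      using e below_nonneg[OF g_below] by (simp add: sum_nonneg ennreal_plus sum_ennreal)
    also have "(\<Sum>i<n. ennreal (\<Lambda> (g n i))) \<le> (\<Sum>i<n. open_mass (U i))"
      by (intro sum_mono open_mass_ge g_below)
    also have "\<dots> \<le> (\<Sum>n. open_mass (U n))" by (intro sum_le_suminf) auto
    finally show "ennreal (\<Lambda> f) \<le> (\<Sum>n. open_mass (U n)) + ennreal e" by (simp add: add_right_mono)
  qed
qed

section \<open>Outer measure of a positive functional and measurability of open sets\<close>

lemma outer_measure_space_outer_mass: "outer_measure_space UNIV outer_mass"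
  unfolding outer_measure_space_def
proof (intro conjI)
  show "positive UNIV outer_mass"
    by (simp add: positive_def outer_mass_open open_mass_empty)
  show "increasing UNIV outer_mass"
    unfolding increasing_def outer_mass_def by (auto intro!: INF_superset_mono)
  show "countably_subadditive UNIV outer_mass"
    unfolding countably_subadditive_def
  proof (intro allI impI)
    fix A :: "nat \<Rightarrow> 'a set"
    show "outer_mass (\<Union>n. A n) \<le> (\<Sum>n. outer_mass (A n))"
    proof (rule ennreal_le_epsilon)
      fix e :: real assume fin: "(\<Sum>n. outer_mass (A n)) < top" and e: "0 < e"
      \<comment> \<open>The errors e / 2^(n+1) sum to e. Finiteness of the total makes each
        \<open>outer_mass (A n)\<close> finite, so that adding a positive error strictly increases
        it and the infimum can be approximated.\<close>
      have "\<exists>U. open U \<and> A n \<subseteq> U \<and> open_mass U \<le> outer_mass (A n) + ennreal (e * (1 / 2) ^ Suc n)" for n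
      proof -
        have "outer_mass (A n) < top"
          using fin by (metis ennreal_suminf_lessD)
        then have "outer_mass (A n) < outer_mass (A n) + ennreal (e * (1 / 2) ^ Suc n)"
          using e by (simp add: ennreal_add_left_cancel_less[of _ 0, simplified])
        then show ?thesis
          unfolding outer_mass_def[of "A n", THEN arg_cong[of _ _ "\<lambda>a. a < _"]] INF_less_iff
          by (auto intro: less_imp_le)
      qed
      then obtain U where U: "\<And>n. open (U n)" "\<And>n. A n \<subseteq> U n"
        "\<And>n. open_mass (U n) \<le> outer_mass (A n) + ennreal (e * (1 / 2) ^ Suc n)" by metis
      have "outer_mass (\<Union>n. A n) \<le> open_mass (\<Union>n. U n)"
        using U by (intro outer_mass_le) auto
      also have "\<dots> \<le> (\<Sum>n. open_mass (U n))" using U(1) by (rule open_mass_countable_subadditive)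
      also have "\<dots> \<le> (\<Sum>n. outer_mass (A n) + ennreal (e * (1 / 2) ^ Suc n))"
        using U(3) by (intro suminf_le) auto
      also have "\<dots> = (\<Sum>n. outer_mass (A n)) + (\<Sum>n. ennreal (e * (1 / 2) ^ Suc n))"
        by (intro suminf_add[symmetric]) auto
      also have "(\<Sum>n. ennreal (e * (1 / 2) ^ Suc n)) = ennreal e"
        using e power_half_series[THEN sums_mult, of e] by (intro suminf_ennreal_eq) auto
      finally show "outer_mass (\<Union>n. A n) \<le> (\<Sum>n. outer_mass (A n)) + ennreal e" .
    qed
  qed
qed

text \<open>For f below V \<inter> U, the truncation k = max 0 (f - e) vanishes on the open set W
  where f < e inside V, and W contains V - U. Hence k plus any g below W is still below V, and
  replacing f by k costs at most e.\<close>

lemma outer_mass_split_open: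
  assumes U: "open U" and V: "open V"
  shows "open_mass (V \<inter> U) + outer_mass (V - U) \<le> open_mass V"
proof -
  have "ennreal (\<Lambda> f) + outer_mass (V - U) \<le> open_mass V" if "below (V \<inter> U) f" for f
  proof (rule ennreal_le_epsilon)
    fix e :: real assume e: "0 < e"
    have f: "continuous_on UNIV f" "\<And>x. 0 \<le> f x" "\<And>x. f x \<le> indicator (V \<inter> U) x"
      using that by (auto simp: below_def)
    have f0: "f x = 0" if "x \<notin> V \<inter> U" for x using f(2)[of x] f(3)[of x] that by simp
    have f1: "f x \<le> 1" for x using f(3)[of x] by (cases "x \<in> V \<inter> U") auto
    define k where "k x = max 0 (f x - e)" for x
    define W where "W = V \<inter> {x. f x < e}"
    have k: "continuous_on UNIV k" unfolding k_def by (intro continuous_intros f)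
    have kb: "below V k"
      unfolding below_def
    proof (intro conjI allI k)
      show "k x \<le> indicator V x" for x
        using f0[of x] f1[of x] e by (cases "x \<in> V") (auto simp: k_def)
    qed (simp add: k_def)
    have "open W" unfolding W_def using V open_Collect_less[OF f(1) continuous_on_const] by auto
    moreover have "V - U \<subseteq> W" using f0 e by (auto simp: W_def)
    ultimately have UW: "outer_mass (V - U) \<le> open_mass W" by (rule outer_mass_le)
    have kW: "ennreal (\<Lambda> k) + open_mass W \<le> open_mass V"
    proof -
      have "ennreal (\<Lambda> k) + ennreal (\<Lambda> g) \<le> open_mass V" if g: "below W g" for g
      proof -
        have "below V (\<lambda>x. k x + g x)"
        proof -
          have "k x + g x \<le> indicator V x" for x
          proof (cases "x \<in> W")
            case True
            then have "k x = 0" "x \<in> V" by (auto simp: W_def k_def)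
            moreover have "g x \<le> indicator W x" using g by (simp add: below_def)
            ultimately show ?thesis using True by simp
          next
            case False
            moreover have "0 \<le> g x" "g x \<le> indicator W x" using g by (auto simp: below_def)
            ultimately have "g x = 0" by simp
            then show ?thesis using kb by (simp add: below_def)
          qed
          moreover have "continuous_on UNIV (\<lambda>x. k x + g x)"
            using g k by (intro continuous_intros) (simp_all add: below_def)
          ultimately show ?thesis using g kb by (simp add: below_def)
        qed
        then have "ennreal (\<Lambda> (\<lambda>x. k x + g x)) \<le> open_mass V" by (rule open_mass_ge)
        moreover have "\<Lambda> (\<lambda>x. k x + g x) = \<Lambda> k + \<Lambda> g" using g k by (intro \<Lambda>_add) (auto simp: below_def)
        ultimately show ?thesis using below_nonneg[OF kb] below_nonneg[OF g] by (simp add: ennreal_plus)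
      qed
      then have "(SUP g\<in>{g. below W g}. ennreal (\<Lambda> k) + ennreal (\<Lambda> g)) \<le> open_mass V"
        by (intro SUP_least) simp
      moreover have "{g. below W g} \<noteq> {}" using below_zero by blast
      ultimately show ?thesis unfolding open_mass_def[of W] by (simp add: ennreal_SUP_add_right)
    qed
    have fk: "ennreal (\<Lambda> f) \<le> ennreal (\<Lambda> k) + ennreal e"
    proof -
      have "\<Lambda> f \<le> \<Lambda> (\<lambda>x. k x + e)" using k f by (intro \<Lambda>_mono continuous_intros) (auto simp: k_def)
      also have "\<dots> = \<Lambda> k + e" using k by (subst \<Lambda>_add) (auto simp: \<Lambda>_const)
      finally have "ennreal (\<Lambda> f) \<le> ennreal (\<Lambda> k + e)" by (rule ennreal_leI)
      then show ?thesis using e below_nonneg[OF kb] by simp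
    qed
    have "ennreal (\<Lambda> f) + outer_mass (V - U) \<le> (ennreal (\<Lambda> k) + ennreal e) + open_mass W"
      by (intro add_mono fk UW)
    also have "\<dots> = (ennreal (\<Lambda> k) + open_mass W) + ennreal e" by (simp only: ac_simps)
    also have "\<dots> \<le> open_mass V + ennreal e" by (intro add_mono kW order_refl)
    finally show "ennreal (\<Lambda> f) + outer_mass (V - U) \<le> open_mass V + ennreal e" .
  qed
  then have "(SUP f\<in>{f. below (V \<inter> U) f}. ennreal (\<Lambda> f) + outer_mass (V - U)) \<le> open_mass V"
    by (intro SUP_least) simp
  moreover have "{f. below (V \<inter> U) f} \<noteq> {}" using below_zero by blast
  ultimately show ?thesis unfolding open_mass_def[of "V \<inter> U"] by (simp add: ennreal_SUP_add_left)
qed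

text \<open>Caratheodory's criterion for an arbitrary test set A reduces to open V containing A,
  since \<open>outer_mass A\<close> is an infimum over such V; the other inequality is
  subadditivity.\<close>

lemma open_in_lambda_system:
  assumes U: "open U"
  shows "U \<in> lambda_system UNIV UNIV outer_mass"
proof -
  have "outer_mass (A \<inter> U) + outer_mass (A - U) \<le> outer_mass A" for A
    unfolding outer_mass_def[of A]
  proof (rule INF_greatest)
    fix V assume "V \<in> {V. open V \<and> A \<subseteq> V}"
    then have V: "open V" "A \<subseteq> V" by auto
    have inc: "B \<subseteq> C \<Longrightarrow> outer_mass B \<le> outer_mass C" for B C
      using outer_measure_space_outer_mass by (auto simp: outer_measure_space_def increasing_def)
    have "outer_mass (A \<inter> U) + outer_mass (A - U) \<le> outer_mass (V \<inter> U) + outer_mass (V - U)"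
      using V by (intro add_mono inc) auto
    also have "\<dots> \<le> open_mass V"
      using outer_mass_split_open[OF U V(1)] U V by (simp add: outer_mass_open open_Int)
    finally show "outer_mass (A \<inter> U) + outer_mass (A - U) \<le> open_mass V" .
  qed
  moreover have "outer_mass A \<le> outer_mass (A \<inter> U) + outer_mass (A - U)" for A
  proof -
    interpret algebra "UNIV :: 'a set" UNIV by (metis Pow_UNIV algebra_Pow)
    have "subadditive UNIV outer_mass"
      using outer_measure_space_outer_mass
      by (auto simp: outer_measure_space_def intro: countably_subadditive_subadditive)
    then have "outer_mass ((A \<inter> U) \<union> (A - U)) \<le> outer_mass (A \<inter> U) + outer_mass (A - U)"
      unfolding subadditive_def by (metis Diff_disjoint Int_Diff UNIV_I inf_assoc inf_bot_right)
    then show ?thesis by (simp add: Int_Diff_Un)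
  qed
  ultimately show ?thesis
    unfolding lambda_system_def by (auto simp: Compl_eq_Diff_UNIV[symmetric] Diff_eq Int_commute intro!: antisym)
qed

section \<open>The Riesz measure and its integrals\<close>

definition riesz_measure :: "'a measure" where
  "riesz_measure = measure_of UNIV (sets borel) outer_mass"

lemma sets_riesz_measure: "sets riesz_measure = sets borel"
  unfolding riesz_measure_def using sets.sigma_sets_eq[of "borel :: 'a measure"] by (simp add: sets_measure_of_conv)

text \<open>\<open>measure_of\<close> keeps a set function only where it is a measure.
  Caratheodory's theorem makes \<open>outer_mass\<close> countably additive on its measurable sets,
  a sigma algebra that contains the open sets and so the Borel sets.\<close>

lemma emeasure_riesz_measure:
  assumes "A \<in> sets borel"
  shows "emeasure riesz_measure A = outer_mass A"
proof -
  interpret S: sigma_algebra "UNIV :: 'a set" UNIV by (metis Pow_UNIV sigma_algebra_Pow)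
  have ms: "measure_space UNIV (lambda_system UNIV UNIV outer_mass) outer_mass"
    by (rule S.caratheodory_lemma[OF outer_measure_space_outer_mass])
  then interpret L: sigma_algebra UNIV "lambda_system UNIV UNIV outer_mass"
    by (simp add: measure_space_def)
  have sub: "sets borel \<subseteq> lambda_system UNIV UNIV outer_mass"
  proof -
    have "Collect open \<subseteq> lambda_system UNIV UNIV outer_mass" using open_in_lambda_system by auto
    then have "sigma_sets UNIV (Collect open) \<subseteq> lambda_system UNIV UNIV outer_mass"
      by (rule L.sigma_sets_subset)
    then show ?thesis by (simp add: borel_def)
  qed
  show ?thesis
    unfolding riesz_measure_def
  proof (rule emeasure_measure_of_sigma[OF _ _ _ assms])
    show "sigma_algebra UNIV (sets (borel :: 'a measure))" using sets.sigma_algebra_axioms[of borel] by simp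
    show "positive (sets borel) outer_mass"
      using ms by (simp add: measure_space_def positive_def)
    have "countably_additive (lambda_system UNIV UNIV outer_mass) outer_mass"
      using ms by (simp add: measure_space_def)
    then show "countably_additive (sets borel) outer_mass"
      using sub unfolding countably_additive_def by blast
  qed
qed

lemma prob_space_riesz_measure: "prob_space riesz_measure"
  using sets_eq_imp_space_eq[OF sets_riesz_measure]
  by (intro prob_spaceI) (simp add: emeasure_riesz_measure outer_mass_open open_mass_UNIV)

text \<open>The mass of an open set is a supremum over competitors. A mass of at most e is handled
  by the zero function, so in the remaining case the mass minus e is positive and passing through
  \<open>ennreal\<close> truncates nothing.\<close>

lemma measure_riesz_approx:
  assumes U: "open U" and e: "0 < e"
  obtains g where "below U g" "measure riesz_measure U \<le> \<Lambda> g + e"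
proof (cases "measure riesz_measure U \<le> e")
  case True
  then show thesis using that[OF below_zero] by (simp add: \<Lambda>_const)
next
  case False
  interpret prob_space riesz_measure by (rule prob_space_riesz_measure)
  have "ennreal (measure riesz_measure U - e) < ennreal (measure riesz_measure U)"
    using e False by (intro ennreal_lessI) auto
  also have "\<dots> = open_mass U"
    using U by (simp add: emeasure_riesz_measure outer_mass_open flip: emeasure_eq_measure)
  finally obtain g where "below U g" "ennreal (measure riesz_measure U - e) < ennreal (\<Lambda> g)"
    unfolding open_mass_def less_SUP_iff by auto
  moreover then have "measure riesz_measure U - e < \<Lambda> g"
    using False by (subst (asm) ennreal_less_iff) auto
  ultimately show thesis using that by auto
qed

lemma integrable_riesz:
  assumes "continuous_on UNIV f"
  shows "integrable riesz_measure (f :: 'a \<Rightarrow> real)"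
proof -
  interpret prob_space riesz_measure by (rule prob_space_riesz_measure)
  obtain B where "\<And>x. \<bar>f x\<bar> \<le> B"
    using compact_imp_bounded[OF compact_continuous_image[OF assms compact_UNIV]]
    by (auto simp: bounded_iff)
  then show ?thesis
    using borel_measurable_continuous_onI[OF assms]
    by (intro integrable_const_bound[of _ B]) (auto simp: measurable_cong_sets[OF sets_riesz_measure refl])
qed

text \<open>Layer cake: n f is nearly the sum of n indicators of open level sets, each replaced by
  some g i below it. The n approximation errors e / 2 become e / 2 after division by n, and the
  discretization adds 1 / n < e / 2.\<close>

lemma integral_riesz_le_unit:
  assumes f: "continuous_on UNIV f" "\<And>x. 0 \<le> f x" "\<And>x. f x \<le> 1"
  shows "(\<integral>x. f x \<partial>riesz_measure) \<le> \<Lambda> f"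
proof (rule field_le_epsilon)
  interpret prob_space riesz_measure by (rule prob_space_riesz_measure)
  have sp: "space riesz_measure = UNIV" using sets_eq_imp_space_eq[OF sets_riesz_measure] by simp
  fix e :: real assume "0 < e"
  then obtain n where n: "0 < n" "1 / real n < e / 2"
    using reals_Archimedean[of "e / 2"] by (metis half_gt_zero inverse_eq_divide zero_less_Suc)
  \<comment> \<open>The shift by 1 makes the sum of the indicators at most n f, as needed for the
    comparison under \<Lambda>, and still at least n f - 1.\<close>
  define U where "U i = {x. real i + 1 < real n * f x}" for i
  have oU: "open (U i)" for i
    unfolding U_def by (intro open_Collect_less continuous_intros f)
  have ind: "(\<Sum>i<n. indicator (U i) x) = (\<Sum>i<n. if real i + 1 < real n * f x then 1 else 0 :: real)" for x
    by (intro sum.cong) (simp_all add: U_def indicator_def)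
  have lo: "real n * f x - 1 \<le> (\<Sum>i<n. indicator (U i) x)"
    and hi: "(\<Sum>i<n. indicator (U i) x) \<le> real n * f x" for x
  proof -
    have "0 \<le> real n * f x" "real n * f x \<le> real n * 1"
      using f by (simp, intro mult_left_mono) auto
    then show "real n * f x - 1 \<le> (\<Sum>i<n. indicator (U i) x)" "(\<Sum>i<n. indicator (U i) x) \<le> real n * f x"
      unfolding ind using sum_threshold_bounds[of "real n * f x" n] by auto
  qed
  have "\<exists>g. below (U i) g \<and> measure riesz_measure (U i) \<le> \<Lambda> g + e / 2" for i
    using measure_riesz_approx[OF oU[of i], of "e / 2"] \<open>0 < e\<close> by auto
  then obtain g where g: "\<And>i. below (U i) (g i)" "\<And>i. measure riesz_measure (U i) \<le> \<Lambda> (g i) + e / 2"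
    by metis
  have int: "integrable riesz_measure (indicator (U i) :: 'a \<Rightarrow> real)" for i
    using oU by (intro integrable_real_indicator) (simp_all add: sets_riesz_measure emeasure_eq_measure)
  have "real n * (\<integral>x. f x \<partial>riesz_measure) - 1 = (\<integral>x. real n * f x - 1 \<partial>riesz_measure)"
    using integrable_riesz[OF f(1)] prob_space by (simp add: sp)
  also have "\<dots> \<le> (\<integral>x. (\<Sum>i<n. indicator (U i) x) \<partial>riesz_measure)"
    using integrable_riesz[OF f(1)] int lo by (intro integral_mono) auto
  also have "\<dots> = (\<Sum>i<n. measure riesz_measure (U i))"
    using int by (subst Bochner_Integration.integral_sum) (auto simp: sp)
  also have "\<dots> \<le> (\<Sum>i<n. \<Lambda> (g i) + e / 2)" by (intro sum_mono g)
  also have "\<dots> = \<Lambda> (\<lambda>x. \<Sum>i<n. g i x) + real n * (e / 2)"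
    using g by (simp add: sum.distrib \<Lambda>_sum below_def)
  also have "\<Lambda> (\<lambda>x. \<Sum>i<n. g i x) \<le> \<Lambda> (\<lambda>x. real n * f x)"
  proof (rule \<Lambda>_mono)
    show "continuous_on UNIV (\<lambda>x. \<Sum>i<n. g i x)"
      using g by (intro continuous_on_sum) (auto simp: below_def)
    fix x
    have "(\<Sum>i<n. g i x) \<le> (\<Sum>i<n. indicator (U i) x)"
      using g by (intro sum_mono) (auto simp: below_def)
    then show "(\<Sum>i<n. g i x) \<le> real n * f x" using hi[of x] by linarith
  qed (intro continuous_intros f)
  also have "\<dots> = real n * \<Lambda> f" using f by (intro \<Lambda>_scale)
  finally have "(\<integral>x. f x \<partial>riesz_measure) \<le> \<Lambda> f + e / 2 + 1 / real n"
    using n by (simp add: field_simps)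
  then show "(\<integral>x. f x \<partial>riesz_measure) \<le> \<Lambda> f + e" using n by simp
qed

text \<open>The map t to (t + B) / (2 B) carries the range of f into the unit interval, and the
  integral and \<Lambda> transform alike because both give constants their own value.\<close>

lemma integral_riesz_le:
  assumes f: "continuous_on UNIV f"
  shows "(\<integral>x. f x \<partial>riesz_measure) \<le> \<Lambda> f"
proof -
  interpret prob_space riesz_measure by (rule prob_space_riesz_measure)
  have sp: "space riesz_measure = UNIV" using sets_eq_imp_space_eq[OF sets_riesz_measure] by simp
  obtain B where B: "0 < B" "\<And>x. \<bar>f x\<bar> \<le> B"
    using compact_imp_bounded[OF compact_continuous_image[OF f compact_UNIV]]
    by (auto simp: bounded_pos)
  define g where "g x = (1 / (2 * B)) * (f x + B)" for x
  have "continuous_on UNIV (\<lambda>x. f x + B)" by (intro continuous_intros f)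
  then have "\<Lambda> g = (1 / (2 * B)) * (\<Lambda> f + B)"
    unfolding g_def using \<Lambda>_add[OF f continuous_on_const] by (simp only: \<Lambda>_scale \<Lambda>_const)
  moreover have "(\<integral>x. g x \<partial>riesz_measure) = (1 / (2 * B)) * ((\<integral>x. f x \<partial>riesz_measure) + B)"
    unfolding g_def using integrable_riesz[OF f] prob_space
    by (subst integral_mult_right_zero, subst Bochner_Integration.integral_add) (auto simp: sp)
  moreover have "(\<integral>x. g x \<partial>riesz_measure) \<le> \<Lambda> g"
  proof (rule integral_riesz_le_unit)
    show "continuous_on UNIV g" unfolding g_def by (intro continuous_intros f)
    show "0 \<le> g x" "g x \<le> 1" for x
      using B(1) B(2)[of x] by (auto simp: g_def field_simps abs_le_iff)
  qed
  ultimately show ?thesis using B(1) by (simp add: divide_le_cancel)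
qed

theorem integral_riesz_measure:
  assumes f: "continuous_on UNIV f"
  shows "(\<integral>x. f x \<partial>riesz_measure) = \<Lambda> f"
proof (rule antisym)
  show "(\<integral>x. f x \<partial>riesz_measure) \<le> \<Lambda> f" using f by (rule integral_riesz_le)
  have "(\<integral>x. - 1 * f x \<partial>riesz_measure) \<le> \<Lambda> (\<lambda>x. - 1 * f x)"
    by (intro integral_riesz_le continuous_intros f)
  then show "\<Lambda> f \<le> (\<integral>x. f x \<partial>riesz_measure)" using \<Lambda>_scale[OF f, of "- 1"] by simp
qed

end

corollary riesz_representation:
  fixes L :: "('a::topological_space \<Rightarrow>\<^sub>C real) \<Rightarrow> real"
  assumes compact: "compact (UNIV :: 'a set)"
    and zero_set: "\<And>C :: 'a set. closed C \<Longrightarrow>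
      \<exists>h. continuous_on UNIV h \<and> (\<forall>x. (0::real) \<le> h x) \<and> C = {x. h x = 0}"
    and L: "linear L" and nonneg: "\<And>f. (\<And>x. 0 \<le> apply_bcontfun f x) \<Longrightarrow> 0 \<le> L f"
    and one: "L (const_bcontfun 1) = 1"
  obtains M where "prob_space M" "sets M = sets borel" "\<And>f. (\<integral>x. apply_bcontfun f x \<partial>M) = L f"
proof -
  \<comment> \<open>On a discontinuous f this value is unspecified; every property below is asked of
    continuous functions.\<close>
  define \<Lambda> where "\<Lambda> f = L (Bcontfun f)" for f
  note app = apply_Bcontfun[OF compact zero_set]
  have add: "\<Lambda> (\<lambda>x. f x + g x) = \<Lambda> f + \<Lambda> g" if "continuous_on UNIV f" "continuous_on UNIV g" for f g
  proof -
    have "Bcontfun (\<lambda>x. f x + g x) = Bcontfun f + Bcontfun g"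
      using that by (intro bcontfun_eqI) (simp add: app continuous_on_add)
    then show ?thesis by (simp add: \<Lambda>_def linear_add[OF L])
  qed
  have scale: "\<Lambda> (\<lambda>x. c * f x) = c * \<Lambda> f" if "continuous_on UNIV f" for f c
  proof -
    have "Bcontfun (\<lambda>x. c * f x) = c *\<^sub>R Bcontfun f"
      using that by (intro bcontfun_eqI) (simp add: app continuous_on_mult_left)
    then show ?thesis by (simp add: \<Lambda>_def linear_scale[OF L])
  qed
  have pos: "0 \<le> \<Lambda> f" if "continuous_on UNIV f" "\<And>x. 0 \<le> f x" for f
    unfolding \<Lambda>_def using that by (intro nonneg) (simp add: app)
  have "\<Lambda> (\<lambda>_. 1) = 1" using one by (simp add: \<Lambda>_def const_bcontfun_def)
  note hyps = compact zero_set add scale pos this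
  show thesis
  proof (rule that)
    show "prob_space (riesz_measure \<Lambda>)" by (rule prob_space_riesz_measure) (fact hyps)+
    show "sets (riesz_measure \<Lambda>) = sets borel" by (rule sets_riesz_measure) (fact hyps)+
    have "(\<integral>x. f x \<partial>riesz_measure \<Lambda>) = \<Lambda> f" if "continuous_on UNIV f" for f
      by (rule integral_riesz_measure) (fact hyps that)+
    then show "(\<integral>x. apply_bcontfun f x \<partial>riesz_measure \<Lambda>) = L f" for f
      by (simp add: \<Lambda>_def apply_bcontfun_inverse)
  qed
qed

subsection \<open>Mutual singularity of ergodic measures\<close>

text \<open>Cutting X along the disjointed sequence yields pieces each inside a single A n, where
  the inequality is known; countable additivity sums them.\<close>

lemma positive_set_Union:
  fixes M N :: "'a measure" and A :: "nat \<Rightarrow> 'a set"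
  assumes sets: "sets N = sets M" and A: "\<And>n. A n \<in> sets M"
    and pos: "\<And>n X. X \<in> sets M \<Longrightarrow> X \<subseteq> A n \<Longrightarrow> emeasure N X \<le> emeasure M X"
    and X: "X \<in> sets M" "X \<subseteq> (\<Union>n. A n)"
  shows "emeasure N X \<le> emeasure M X"
proof -
  define B where "B n = X \<inter> disjointed A n" for n
  have B: "B n \<in> sets M" for n
    unfolding B_def using A X(1) sets.range_disjointed_sets[of A M] by blast
  have dis: "disjoint_family B"
    unfolding B_def using disjoint_family_disjointed[of A] by (auto simp: disjoint_family_on_def)
  have un: "(\<Union>n. B n) = X"
    using X(2) by (auto simp: B_def UN_disjointed_eq simp flip: Int_UN_distrib)
  have "emeasure N X = (\<Sum>n. emeasure N (B n))"
    using B dis un sets by (subst suminf_emeasure) auto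
  also have "\<dots> \<le> (\<Sum>n. emeasure M (B n))"
    using B disjointed_subset[of A] by (intro suminf_le pos) (auto simp: B_def)
  also have "\<dots> = emeasure M X"
    using B dis un by (subst suminf_emeasure) auto
  finally show ?thesis .
qed

lemma continuous_vimage_borel: "continuous_on UNIV f \<Longrightarrow> A \<in> sets borel \<Longrightarrow> f -` A \<in> sets borel"
  using measurable_sets[OF borel_measurable_continuous_onI, of f A] by simp

lemma ergodic_measuresD:
  assumes "M \<in> ergodic_measures T"
  shows "sets M = sets borel" "prob_space M" "distr M borel T = M" "space M = UNIV"
    "A \<in> sets borel \<Longrightarrow> T -` A = A \<Longrightarrow> measure M A = 0 \<or> measure M A = 1"
  using assms sets_eq_imp_space_eq[of M borel] by (auto simp: ergodic_measures_def)

lemma emeasure_vimage_invariant: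
  assumes "continuous_on UNIV T" "sets M = sets borel" "distr M borel T = M" "A \<in> sets borel"
  shows "emeasure M (T -` A) = emeasure M A"
proof -
  have "emeasure M A = emeasure (distr M borel T) A" using assms(3) by simp
  also have "\<dots> = emeasure M (T -` A \<inter> space M)"
    using assms(2,4) borel_measurable_continuous_onI[OF assms(1)]
    by (intro emeasure_distr) (simp_all cong: measurable_cong_sets)
  finally show ?thesis using sets_eq_imp_space_eq[OF assms(2)] by simp
qed

text \<open>
  The orbit of a positive set of the signed measure \<open>M - N\<close> is again positive, because \<open>M\<close> and \<open>N\<close>
  are invariant. So an invariant set carries the difference.
\<close>

lemma ergodic_measures_singular:
  fixes T S :: "'a::topological_space \<Rightarrow> 'a"
  assumes T: "continuous_on UNIV T" and S: "continuous_on UNIV S"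
    and ST: "\<And>x. S (T x) = x" and TS: "\<And>x. T (S x) = x"
    and M: "M \<in> ergodic_measures T" and N: "N \<in> ergodic_measures T" and ne: "M \<noteq> N"
  obtains A where "A \<in> sets borel" "T -` A = A" "measure M A = 1" "measure N A = 0"
proof -
  note M = ergodic_measuresD[OF M] and N = ergodic_measuresD[OF N]
  interpret M: prob_space M by (rule M)
  interpret N: prob_space N by (rule N)
  have sp [simp]: "space M = UNIV" "space N = UNIV" by (rule M N)+
  have st [simp]: "sets M = sets borel" "sets N = sets borel" by (rule M N)+
  obtain B where B: "B \<in> sets borel" "measure N B < measure M B"
  proof -
    have "\<exists>B\<in>sets borel. measure M B \<noteq> measure N B"
    proof (rule ccontr)
      assume "\<not> ?thesis"
      then have "M = N" by (intro measure_eqI) (auto simp: M.emeasure_eq_measure N.emeasure_eq_measure)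
      with ne show False ..
    qed
    then obtain B where "B \<in> sets borel" "measure M B \<noteq> measure N B" by blast
    moreover have "measure M (- B) = 1 - measure M B" "measure N (- B) = 1 - measure N B"
      using calculation M.prob_compl[of B] N.prob_compl[of B] by (simp_all add: Compl_eq_Diff_UNIV)
    ultimately show thesis using that[of B] that[of "- B"] by (cases "measure N B < measure M B") auto
  qed
  obtain Y where Y: "Y \<in> sets borel" "\<And>X. X \<in> sets borel \<Longrightarrow> X \<subseteq> Y \<Longrightarrow> emeasure N X \<le> emeasure M X"
    "\<And>X. X \<in> sets borel \<Longrightarrow> X \<inter> Y = {} \<Longrightarrow> emeasure M X \<le> emeasure N X"
    using finite_unsigned_Hahn_decomposition[OF M.finite_measure_axioms N.finite_measure_axioms] by auto
  define pos where "pos Z \<longleftrightarrow> Z \<in> sets borel \<and> (\<forall>X\<in>sets borel. X \<subseteq> Z \<longrightarrow> emeasure N X \<le> emeasure M X)" for Z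
  have pos_T: "pos (T -` Z)" if "pos Z" for Z
    unfolding pos_def
  proof (intro conjI ballI impI)
    show "T -` Z \<in> sets borel" using that T by (auto simp: pos_def intro: continuous_vimage_borel)
    fix X assume X: "X \<in> sets borel" "X \<subseteq> T -` Z"
    have eq: "T -` (S -` X) = X" by (auto simp: ST)
    have SX: "S -` X \<in> sets borel" by (rule continuous_vimage_borel[OF S X(1)])
    have "S -` X \<subseteq> Z" using X(2) by (auto simp: subset_iff) (metis TS)
    then have "emeasure N (S -` X) \<le> emeasure M (S -` X)" using that SX by (auto simp: pos_def)
    then show "emeasure N X \<le> emeasure M X"
      using emeasure_vimage_invariant[OF T M(1,3) SX] emeasure_vimage_invariant[OF T N(1,3) SX] by (simp add: eq)
  qed
  have pos_S: "pos (S -` Z)" if "pos Z" for Z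
    unfolding pos_def
  proof (intro conjI ballI impI)
    show "S -` Z \<in> sets borel" using that S by (auto simp: pos_def intro: continuous_vimage_borel)
    fix X assume X: "X \<in> sets borel" "X \<subseteq> S -` Z"
    have TX: "T -` X \<in> sets borel" by (rule continuous_vimage_borel[OF T X(1)])
    have "T -` X \<subseteq> Z" using X(2) by (auto simp: subset_iff) (metis ST)
    then have "emeasure N (T -` X) \<le> emeasure M (T -` X)" using that TX by (auto simp: pos_def)
    then show "emeasure N X \<le> emeasure M X"
      using emeasure_vimage_invariant[OF T M(1,3) X(1)] emeasure_vimage_invariant[OF T N(1,3) X(1)] by simp
  qed
  have pos_UN: "pos (\<Union>n. Z n)" if "\<And>n. pos (Z n)" for Z :: "nat \<Rightarrow> 'a set"
    unfolding pos_def
  proof (intro conjI ballI impI)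
    have Z: "Z n \<in> sets M" for n using that by (simp add: pos_def)
    then show "(\<Union>n. Z n) \<in> sets borel" by auto
    fix X assume X: "X \<in> sets borel" "X \<subseteq> (\<Union>n. Z n)"
    show "emeasure N X \<le> emeasure M X"
      by (rule positive_set_Union[of N M Z]) (use that X Z in \<open>simp_all add: pos_def\<close>)
  qed
  define Z where "Z n = (S ^^ n) -` Y" for n
  \<comment> \<open>Saturating Y by iterates in both directions makes A strictly invariant, not just
    up to null sets: T x adds one step of T, and a step of S cancels one.\<close>
  define A where "A = (\<Union>m. \<Union>n. (T ^^ m) -` Z n)"
  have posY: "pos Y" using Y(1,2) by (auto simp: pos_def)
  have posZ: "pos (Z n)" for n
  proof (induction n)
    case (Suc n)
    have "Z (Suc n) = S -` Z n" by (auto simp: Z_def funpow_swap1)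
    then show ?case using pos_S[OF Suc] by (simp only:)
  qed (simp add: Z_def posY)
  have posTZ: "pos ((T ^^ m) -` Z n)" for m n
  proof (induction m)
    case (Suc m)
    have "(T ^^ Suc m) -` Z n = T -` ((T ^^ m) -` Z n)" by (auto simp: funpow_swap1)
    then show ?case using pos_T[OF Suc] by (simp only:)
  qed (simp add: posZ)
  have posA: "pos A" unfolding A_def by (intro pos_UN posTZ)
  have inv: "T -` A = A"
  proof (intro set_eqI iffI)
    fix x assume "x \<in> T -` A"
    then obtain m n where "(S ^^ n) ((T ^^ m) (T x)) \<in> Y" by (auto simp: A_def Z_def)
    then have "(S ^^ n) ((T ^^ Suc m) x) \<in> Y" by (simp add: funpow_swap1)
    then show "x \<in> A" unfolding A_def Z_def by blast
  next
    fix x assume "x \<in> A"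
    then obtain m n where "(S ^^ n) ((T ^^ m) x) \<in> Y" by (auto simp: A_def Z_def)
    moreover have "(S ^^ Suc n) ((T ^^ m) (T x)) = (S ^^ n) ((T ^^ m) x)"
      by (simp add: funpow_swap1[of S] funpow_swap1[of T, symmetric] ST)
    ultimately have "(S ^^ Suc n) ((T ^^ m) (T x)) \<in> Y" by (simp only:)
    then show "x \<in> T -` A" unfolding A_def Z_def by blast
  qed
  have YA: "Y \<subseteq> A"
  proof
    fix x assume "x \<in> Y"
    then have "x \<in> (T ^^ 0) -` Z 0" by (simp add: Z_def)
    then show "x \<in> A" unfolding A_def by blast
  qed
  have A: "A \<in> sets borel" using posA by (simp add: pos_def)
  have le: "measure N X \<le> measure M X" if "X \<in> sets borel" "X \<subseteq> A" for X
    using posA that unfolding pos_def by (auto simp: M.emeasure_eq_measure N.emeasure_eq_measure)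
  \<comment> \<open>Off Y the measure N dominates, so the excess of M on B must lie in B \<inter> Y.
    The rest of the positive set A cannot undo it, so N A < M A, and ergodicity leaves only the
    values 0 and 1.\<close>
  have "measure M (B - Y) \<le> measure N (B - Y)"
    using Y(3)[of "B - Y"] B Y(1) by (auto simp: M.emeasure_eq_measure N.emeasure_eq_measure)
  then have "measure N (B \<inter> Y) < measure M (B \<inter> Y)"
    using B Y(1) M.finite_measure_Diff'[of B Y] N.finite_measure_Diff'[of B Y] by simp
  moreover have "measure N (A - B \<inter> Y) \<le> measure M (A - B \<inter> Y)"
    using A B Y(1) by (intro le) auto
  moreover have "measure N (A - B \<inter> Y) = measure N A - measure N (B \<inter> Y)"
    "measure M (A - B \<inter> Y) = measure M A - measure M (B \<inter> Y)"
    using A B Y(1) YA by (auto intro!: M.finite_measure_Diff N.finite_measure_Diff)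
  ultimately have "measure N A < measure M A" by linarith
  then have "measure M A = 1" "measure N A = 0"
    using M(5)[OF A inv] N(5)[OF A inv] by (auto simp del: st)
  then show thesis using that[OF A inv] by blast
qed

text \<open>Intersecting the sets that separate M from the other members of I gives one set of full
  M-measure that is null for all the others; evaluating there isolates \<open>c M\<close>.\<close>

lemma ergodic_measures_independent:
  fixes T S :: "'a::topological_space \<Rightarrow> 'a"
  assumes T: "continuous_on UNIV T" and S: "continuous_on UNIV S"
    and ST: "\<And>x. S (T x) = x" and TS: "\<And>x. T (S x) = x"
    and I: "finite I" "I \<subseteq> ergodic_measures T" "M \<in> I"
    and zero: "\<And>A. A \<in> sets borel \<Longrightarrow> (\<Sum>N\<in>I. c N * measure N A) = 0"
  shows "c M = 0"
proof -
  have "\<exists>A. A \<in> sets borel \<and> measure M A = 1 \<and> measure N A = 0" if "N \<in> I - {M}" for N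
  proof -
    have "M \<in> ergodic_measures T" "N \<in> ergodic_measures T" "M \<noteq> N" using that I by auto
    then show ?thesis by (rule ergodic_measures_singular[OF T S ST TS]) auto
  qed
  then obtain A where A: "\<And>N. N \<in> I - {M} \<Longrightarrow> A N \<in> sets borel"
    "\<And>N. N \<in> I - {M} \<Longrightarrow> measure M (A N) = 1" "\<And>N. N \<in> I - {M} \<Longrightarrow> measure N (A N) = 0" by metis
  note D = ergodic_measuresD[OF subsetD[OF I(2)]]
  define B where "B = (\<Inter>N\<in>I - {M}. A N)"
  have B: "B \<in> sets borel"
  proof (cases "I - {M} = {}")
    case True
    then show ?thesis unfolding B_def by (simp only: INT_empty) simp
  next
    case False
    then show ?thesis unfolding B_def using A(1) I(1) by (intro sets.finite_INT) auto
  qed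
  have MB: "measure M B = 1"
  proof -
    interpret prob_space M by (rule D(2)[OF I(3)])
    have "AE x in M. \<forall>N\<in>I - {M}. x \<in> A N"
      using I(1) A(1,2) D(1)[OF I(3)] by (intro AE_finite_allI) (auto simp: prob_eq_1)
    then have "AE x in M. x \<in> B" by eventually_elim (auto simp: B_def)
    then show ?thesis using B D(1)[OF I(3)] by (simp add: prob_eq_1)
  qed
  have NB: "measure N B = 0" if N: "N \<in> I - {M}" for N
  proof -
    interpret prob_space N using D(2) N by blast
    have "measure N B \<le> measure N (A N)"
      using N A(1)[OF N] D(1)[of N] by (intro finite_measure_mono) (auto simp: B_def)
    then show ?thesis using A(3)[OF N] by (simp add: antisym)
  qed
  have "0 = (\<Sum>N\<in>I. c N * measure N B)" using zero[OF B] by simp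
  also have "\<dots> = c M * measure M B + (\<Sum>N\<in>I - {M}. c N * measure N B)"
    using I by (simp add: sum.remove)
  also have "\<dots> = c M" using NB MB by simp
  finally show ?thesis by simp
qed

subsection \<open>Functions with vanishing ergodic integrals\<close>

text \<open>Nonnegativity of q on B bounds q (f + g) below by - q (- f), so the infimum is finite.
  The linear functionals below p are exactly those below q that vanish on B.\<close>

lemma sublinear_INF_subspace:
  assumes q: "sublinear q" and B: "subspace B" and nonneg: "\<And>g. g \<in> B \<Longrightarrow> 0 \<le> q g"
  defines "p \<equiv> \<lambda>f. INF g\<in>B. q (f + g)"
  shows "sublinear p" and "\<And>f g. g \<in> B \<Longrightarrow> p f \<le> q (f + g)"
proof -
  have ne: "B \<noteq> {}" using subspace_0[OF B] by blast
  have bdd: "bdd_below ((\<lambda>g. q (f + g)) ` B)" for f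
  proof (rule bdd_belowI2[of _ "- q (- f)"])
    fix g assume "g \<in> B"
    then show "- q (- f) \<le> q (f + g)" using nonneg[of g] sublinear_add[OF q, of "f + g" "- f"] by simp
  qed
  have p_le: "p f \<le> q (f + g)" if "g \<in> B" for f g
    unfolding p_def using that bdd by (intro cINF_lower)
  then show "\<And>f g. g \<in> B \<Longrightarrow> p f \<le> q (f + g)" .
  have p_ge: "c \<le> p f" if "\<And>g. g \<in> B \<Longrightarrow> c \<le> q (f + g)" for c f
    unfolding p_def using that ne by (intro cINF_greatest)
  show "sublinear p" unfolding sublinear_def
  proof (intro conjI allI impI)
    fix x y
    have "p (x + y) - q (x + g) \<le> p y" if g: "g \<in> B" for g
    proof (rule p_ge)
      fix k assume k: "k \<in> B"
      have "p (x + y) \<le> q ((x + g) + (y + k))"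
        using p_le[OF subspace_add[OF B g k], of "x + y"] by (simp add: ac_simps)
      then show "p (x + y) - q (x + g) \<le> q (y + k)"
        using sublinear_add[OF q, of "x + g" "y + k"] by simp
    qed
    then have "p (x + y) - p y \<le> p x" by (intro p_ge) (simp add: algebra_simps)
    then show "p (x + y) \<le> p x + p y" by simp
  next
    have le: "t * p x \<le> p (t *\<^sub>R x)" if t: "0 < t" for t x
    proof (rule p_ge)
      fix g assume g: "g \<in> B"
      have "t * p x \<le> t * q (x + (1 / t) *\<^sub>R g)"
        using t g by (intro mult_left_mono p_le subspace_scale B) auto
      also have "\<dots> = q (t *\<^sub>R x + g)"
        using t sublinear_scale[OF q, of t "x + (1 / t) *\<^sub>R g"] by (simp add: scaleR_add_right)
      finally show "t * p x \<le> q (t *\<^sub>R x + g)" .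
    qed
    fix t :: real and x assume t: "0 \<le> t"
    show "p (t *\<^sub>R x) = t * p x"
    proof (cases "t = 0")
      case True
      have "p 0 = 0"
      proof (rule antisym)
        show "p 0 \<le> 0" using p_le[OF subspace_0[OF B], of 0] sublinear_zero[OF q] by simp
        show "0 \<le> p 0" by (rule p_ge) (simp add: nonneg)
      qed
      then show ?thesis using True by simp
    next
      case False
      then have "p (t *\<^sub>R x) \<le> t * p x" using le[of "1 / t" "t *\<^sub>R x"] t by (simp add: field_simps)
      then show ?thesis using le[of t x] t False by simp
    qed
  qed
qed

text \<open>A linear functional below \<open>bsup\<close> is positive and sends the constant 1 to 1,
  so on a compact metrizable space it is integration against a probability measure.\<close>

definition bsup :: "('a::topological_space \<Rightarrow>\<^sub>C real) \<Rightarrow> real" where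
  "bsup f = (SUP x. apply_bcontfun f x)"

lemma bsup_upper: "apply_bcontfun f x \<le> bsup f"
  unfolding bsup_def using bounded_apply_bcontfun[of f]
  by (intro cSUP_upper bounded_imp_bdd_above) auto

lemma bsup_least: "(\<And>x. apply_bcontfun f x \<le> c) \<Longrightarrow> bsup f \<le> c"
  unfolding bsup_def by (rule cSUP_least) auto

lemma sublinear_bsup: "sublinear (bsup :: ('a::topological_space \<Rightarrow>\<^sub>C real) \<Rightarrow> real)"
  unfolding sublinear_def
proof (intro conjI allI impI)
  fix f g :: "'a \<Rightarrow>\<^sub>C real"
  show "bsup (f + g) \<le> bsup f + bsup g" by (rule bsup_least) (simp add: add_mono bsup_upper)
next
  have le: "bsup (t *\<^sub>R f) \<le> t * bsup f" if "0 \<le> t" for t and f :: "'a \<Rightarrow>\<^sub>C real"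
    using that by (intro bsup_least) (simp add: mult_left_mono bsup_upper)
  fix t :: real and f :: "'a \<Rightarrow>\<^sub>C real" assume t: "0 \<le> t"
  show "bsup (t *\<^sub>R f) = t * bsup f"
  proof (cases "t = 0")
    case False
    then have "t * bsup f \<le> bsup (t *\<^sub>R f)" using le[of "1 / t" "t *\<^sub>R f"] t by (simp add: field_simps)
    then show ?thesis using le[OF t, of f] by simp
  qed (simp add: bsup_def)
qed

context
  fixes T S :: "'a::topological_space \<Rightarrow> 'a"
  assumes compact: "compact (UNIV :: 'a set)"
    and zero_set: "\<And>C :: 'a set. closed C \<Longrightarrow>
      \<exists>h. continuous_on UNIV h \<and> (\<forall>x. (0::real) \<le> h x) \<and> C = {x. h x = 0}"
    and T: "continuous_on UNIV T" and S: "continuous_on UNIV S"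
    and ST: "\<And>x. S (T x) = x" and TS: "\<And>x. T (S x) = x"
begin

section \<open>Coboundaries and the upper mean\<close>

lemma subspace_coboundaries: "subspace (coboundaries T)"
  unfolding coboundaries_def
  by (intro linear_subspace_image subspace_UNIV linear_compose_sub linear_koopman T linear_ident)

text \<open>At a minimum point x of h, supplied by compactness, h (T x) - h x \<ge> 0. This keeps
  the infimum in \<open>upper_mean\<close> finite.\<close>

lemma bsup_coboundary_nonneg:
  assumes "g \<in> coboundaries T"
  shows "0 \<le> bsup g"
proof -
  obtain h where g: "g = koopman T h - h" using assms by (auto simp: coboundaries_def)
  obtain x where "\<forall>y. apply_bcontfun h x \<le> apply_bcontfun h y"
    using continuous_attains_inf[OF compact _ continuous_on_apply_bcontfun[of UNIV h]] by auto
  then have "0 \<le> apply_bcontfun g x" by (simp add: g apply_koopman[OF T])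
  then show ?thesis using bsup_upper[of g x] by linarith
qed

text \<open>By \<open>upper_mean_ge\<close> and \<open>ex_ergodic_measure_integral\<close> this is
  the largest integral of f against an invariant probability measure.\<close>

definition upper_mean :: "('a \<Rightarrow>\<^sub>C real) \<Rightarrow> real" where
  "upper_mean f = (INF g\<in>coboundaries T. bsup (f + g))"

lemma sublinear_upper_mean: "sublinear upper_mean"
  unfolding upper_mean_def[abs_def]
  by (rule sublinear_INF_subspace(1)[OF sublinear_bsup subspace_coboundaries bsup_coboundary_nonneg])

lemma upper_mean_le: "g \<in> coboundaries T \<Longrightarrow> upper_mean f \<le> bsup (f + g)"
  unfolding upper_mean_def
  by (rule sublinear_INF_subspace(2)[OF sublinear_bsup subspace_coboundaries bsup_coboundary_nonneg])

text \<open>An invariant L does not see g, so L f = L (f + g), and f + g lies below the constant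
  \<open>bsup (f + g)\<close>.\<close>

lemma upper_mean_ge:
  assumes L: "linear L" and nonneg: "\<And>f. (\<And>x. 0 \<le> apply_bcontfun f x) \<Longrightarrow> 0 \<le> L f"
    and one: "L (const_bcontfun 1) = 1" and inv: "\<And>h. L (koopman T h) = L h"
  shows "L \<le> upper_mean"
proof (rule le_funI)
  fix f
  show "L f \<le> upper_mean f"
    unfolding upper_mean_def
  proof (rule cINF_greatest)
    show "coboundaries T \<noteq> {}" by (simp add: coboundaries_def)
    fix g assume "g \<in> coboundaries T"
    then have "L g = 0" using inv by (auto simp: coboundaries_def linear_diff[OF L])
    then have "L f = L (f + g)" by (simp add: linear_add[OF L])
    moreover have "0 \<le> L (bsup (f + g) *\<^sub>R const_bcontfun 1 - (f + g))"
      using bsup_upper[of "f + g"] by (intro nonneg) (simp add: algebra_simps)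
    ultimately show "L f \<le> bsup (f + g)"
      by (simp only: linear_diff[OF L] linear_scale[OF L] one) simp
  qed
qed

text \<open>Some coboundary g = h \<circ> T - h has f + g < e, so f is at most e minus a telescoping
  term; its two ends contribute at most 2 norm h, uniformly in n and x.\<close>

lemma birkhoff_sum_le:
  assumes "upper_mean f \<le> 0" "0 < e"
  obtains C where "\<And>n x. (\<Sum>k<n. apply_bcontfun f ((T ^^ k) x)) \<le> real n * e + C"
proof -
  have "(INF g\<in>coboundaries T. bsup (f + g)) < e" using assms by (simp add: upper_mean_def)
  moreover have "coboundaries T \<noteq> {}" by (simp add: coboundaries_def)
  ultimately obtain g where g: "g \<in> coboundaries T" "bsup (f + g) < e"
    using cInf_lessD[of "(\<lambda>g. bsup (f + g)) ` coboundaries T" e] by auto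
  obtain h where h: "g = koopman T h - h" using g(1) by (auto simp: coboundaries_def)
  have "(\<Sum>k<n. apply_bcontfun f ((T ^^ k) x)) \<le> real n * e + (norm h + norm h)" for n x
  proof -
    have "apply_bcontfun f y \<le> e - (apply_bcontfun h (T y) - apply_bcontfun h y)" for y
      using bsup_upper[of "f + g" y] g(2) by (simp add: h apply_koopman[OF T])
    then have "(\<Sum>k<n. apply_bcontfun f ((T ^^ k) x))
        \<le> (\<Sum>k<n. e - (apply_bcontfun h ((T ^^ Suc k) x) - apply_bcontfun h ((T ^^ k) x)))"
      by (intro sum_mono) simp
    also have "\<dots> = real n * e - (apply_bcontfun h ((T ^^ n) x) - apply_bcontfun h x)"
      by (subst sum_subtractf, subst sum_lessThan_telescope[of "\<lambda>k. apply_bcontfun h ((T ^^ k) x)"]) simp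
    also have "\<dots> \<le> real n * e + (norm h + norm h)"
      using norm_bounded[of h "(T ^^ n) x"] norm_bounded[of h x] by simp
    finally show ?thesis .
  qed
  then show thesis by (rule that)
qed

lemma koopman_funpow: "apply_bcontfun ((koopman T ^^ k) f) x = apply_bcontfun f ((T ^^ k) x)"
  by (induction k arbitrary: x) (simp_all add: apply_koopman[OF T] funpow_swap1[of T])

text \<open>A function differs from its Birkhoff averages by coboundaries.\<close>

lemma upper_mean_nonpos_imp_closure:
  assumes "upper_mean f \<le> 0" "upper_mean (- f) \<le> 0"
  shows "f \<in> closure (coboundaries T)"
  unfolding closure_approachable
proof (intro allI impI)
  fix e :: real assume e: "0 < e"
  then have e3: "0 < e / 3" by simp
  obtain C where C: "\<And>n x. (\<Sum>k<n. apply_bcontfun f ((T ^^ k) x)) \<le> real n * (e / 3) + C"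
    using birkhoff_sum_le[OF assms(1) e3] by blast
  obtain D where D: "\<And>n x. (\<Sum>k<n. apply_bcontfun (- f) ((T ^^ k) x)) \<le> real n * (e / 3) + D"
    using birkhoff_sum_le[OF assms(2) e3] by blast
  \<comment> \<open>This n makes C / n and D / n at most e / 3; the 1 in the maximum guarantees n >
    0.\<close>
  obtain n where n: "3 * max (max C D) 1 / e \<le> real n" using real_arch_simple by blast
  have "0 < 3 * max (max C D) 1 / e" using e by simp
  then have n0: "0 < n" using n by (cases n) auto
  have nCD: "C \<le> real n * (e / 3)" "D \<le> real n * (e / 3)" using n e by (auto simp: field_simps)
  define a where "a = (1 / real n) *\<^sub>R (\<Sum>k<n. (koopman T ^^ k) f)"
  have apply_sum: "apply_bcontfun (\<Sum>k<m. (koopman T ^^ k) f) x = (\<Sum>k<m. apply_bcontfun f ((T ^^ k) x))" for m x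
    by (induction m) (simp_all add: koopman_funpow)
  have "norm a \<le> 2 * e / 3"
  proof (rule norm_bound)
    fix x
    have "\<bar>\<Sum>k<n. apply_bcontfun f ((T ^^ k) x)\<bar> \<le> real n * (2 * e / 3)"
      using C[of x n] D[of x n] nCD by (simp add: sum_negf abs_le_iff)
    then show "norm (apply_bcontfun a x) \<le> 2 * e / 3"
      using n0 by (simp add: a_def apply_sum abs_mult field_simps)
  qed
  moreover have "f - a \<in> coboundaries T"
  proof -
    \<comment> \<open>Telescoping: consecutive iterates differ by a coboundary.\<close>
    have iter: "(koopman T ^^ k) f - f \<in> coboundaries T" for k
    proof (induction k)
      case 0
      then show ?case using subspace_0[OF subspace_coboundaries] by simp
    next
      case (Suc k)
      have step: "koopman T ((koopman T ^^ k) f) - (koopman T ^^ k) f \<in> coboundaries T"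
        by (simp add: coboundaries_def)
      then show ?case using subspace_add[OF subspace_coboundaries step Suc] by simp
    qed
    have "(- (1 / real n)) *\<^sub>R (\<Sum>k<n. (koopman T ^^ k) f - f) \<in> coboundaries T"
      by (intro subspace_scale subspace_sum subspace_coboundaries iter)
    moreover have "(- (1 / real n)) *\<^sub>R (\<Sum>k<n. (koopman T ^^ k) f - f) = f - a"
      using n0 by (simp add: a_def sum_subtractf scaleR_diff_right sum_constant_scaleR)
    ultimately show ?thesis by simp
  qed
  ultimately show "\<exists>y\<in>coboundaries T. dist y f < e"
    using e by (intro bexI[of _ "f - a"]) (simp_all add: dist_norm)
qed

section \<open>Invariant integrals, extremality and ergodicity\<close>

lemma integrable_bcontfun:
  assumes "finite_measure M" "sets M = sets borel"
  shows "integrable M (apply_bcontfun (f :: 'a \<Rightarrow>\<^sub>C real))"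
  using assms norm_bounded[of f] borel_measurable_continuous_onI[OF continuous_on_apply_bcontfun[of UNIV f]]
  by (intro finite_measure.integrable_const_bound[of _ _ "norm f"]) (simp_all cong: measurable_cong_sets)

lemma linear_integral_bcontfun:
  assumes "finite_measure M" "sets M = sets borel"
  shows "linear (\<lambda>f :: 'a \<Rightarrow>\<^sub>C real. \<integral>x. apply_bcontfun f x \<partial>M)"
  using integrable_bcontfun[OF assms] by (intro linearI) simp_all

lemma abs_integral_le_norm:
  assumes "prob_space M" "sets M = sets borel"
  shows "\<bar>\<integral>x. apply_bcontfun (f :: 'a \<Rightarrow>\<^sub>C real) x \<partial>M\<bar> \<le> norm f"
proof -
  interpret prob_space M by fact
  have "\<bar>\<integral>x. apply_bcontfun f x \<partial>M\<bar> \<le> (\<integral>x. \<bar>apply_bcontfun f x\<bar> \<partial>M)"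
    by (rule integral_abs_bound)
  also have "\<dots> \<le> (\<integral>x. norm f \<partial>M)"
    using integrable_bcontfun[OF finite_measure_axioms assms(2), of f] norm_bounded[of f]
    by (intro integral_mono) auto
  finally show ?thesis by (simp add: prob_space)
qed

lemma integral_koopman:
  assumes "sets M = sets borel" "distr M borel T = M"
  shows "(\<integral>x. apply_bcontfun (koopman T f) x \<partial>M) = (\<integral>x. apply_bcontfun f x \<partial>M)"
proof -
  have "(\<integral>x. apply_bcontfun f x \<partial>M) = (\<integral>x. apply_bcontfun f x \<partial>distr M borel T)"
    using assms(2) by simp
  also have "\<dots> = (\<integral>x. apply_bcontfun f (T x) \<partial>M)"
    using assms(1) borel_measurable_continuous_onI[OF T]
      borel_measurable_continuous_onI[OF continuous_on_apply_bcontfun[of UNIV f]]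
    by (intro integral_distr) (simp_all cong: measurable_cong_sets)
  finally show ?thesis by (simp add: apply_koopman[OF T])
qed

text \<open>L is integration against M conditioned on A, again an invariant probability measure
  because A is invariant. Such functionals are the competitors in the extremality argument.\<close>

lemma conditional_functional_le:
  assumes M: "prob_space M" "sets M = sets borel" "distr M borel T = M"
    and A: "A \<in> sets borel" "T -` A = A" "0 < measure M A"
  defines "L \<equiv> \<lambda>f. (\<integral>x. indicator A x * apply_bcontfun f x \<partial>M) / measure M A"
  shows "linear L" and "L \<le> upper_mean"
proof -
  interpret prob_space M by (rule M)
  have sp: "space M = UNIV" using sets_eq_imp_space_eq[OF M(2)] by simp
  have meas: "apply_bcontfun f \<in> borel_measurable M" for f :: "'a \<Rightarrow>\<^sub>C real"
    using borel_measurable_integrable[OF integrable_bcontfun[OF finite_measure_axioms M(2)]] .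
  have int: "integrable M (\<lambda>x. indicator A x * apply_bcontfun f x)" for f :: "'a \<Rightarrow>\<^sub>C real"
    using integrable_real_mult_indicator[OF _ integrable_bcontfun[OF finite_measure_axioms M(2)], of A f] A(1) M(2)
    by (simp add: mult.commute)
  show lin: "linear L"
  proof (rule linearI)
    show "L (f + g) = L f + L g" for f g
      using int by (simp add: L_def distrib_left add_divide_distrib)
    show "L (c *\<^sub>R f) = c *\<^sub>R L f" for c f
      using int[of f] by (simp add: L_def mult.left_commute[of _ c])
  qed
  show "L \<le> upper_mean"
  proof (rule upper_mean_ge[OF lin])
    show "0 \<le> L f" if "\<And>x. 0 \<le> apply_bcontfun f x" for f
      unfolding L_def using that by (intro divide_nonneg_nonneg integral_nonneg_AE) auto
    show "L (const_bcontfun 1) = 1" using A M(2) by (simp add: L_def sp)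
    show "L (koopman T f) = L f" for f
    proof -
      have "(\<integral>x. indicator A x * apply_bcontfun f x \<partial>M)
          = (\<integral>x. indicator A x * apply_bcontfun f x \<partial>distr M borel T)"
        using M(3) by simp
      also have "\<dots> = (\<integral>x. indicator A (T x) * apply_bcontfun f (T x) \<partial>M)"
        using M(2) A(1) borel_measurable_continuous_onI[OF T] meas[of f]
        by (intro integral_distr borel_measurable_times borel_measurable_indicator) (simp_all cong: measurable_cong_sets)
      also have "(\<lambda>x. indicator A (T x)) = (indicator A :: 'a \<Rightarrow> real)"
        using A(2) by (auto simp: indicator_def vimage_def fun_eq_iff set_eq_iff)
      finally show ?thesis by (simp add: L_def apply_koopman[OF T])
    qed
  qed
qed

text \<open>Being below \<open>upper_mean\<close> makes L positive, normalized and zero on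
  coboundaries, hence an invariant measure M. An invariant A with 0 < M A < 1 would write L as a
  convex combination of its conditionals on A and - A, which extremality excludes.\<close>

lemma ex_ergodic_measure_integral:
  obtains M where "M \<in> ergodic_measures T" "(\<integral>x. apply_bcontfun f x \<partial>M) = upper_mean f"
proof -
  obtain L where L: "linear L" "L \<le> upper_mean" "L f = upper_mean f"
    and extreme: "\<And>L1 L2 s. \<lbrakk>linear L1; linear L2; L1 \<le> upper_mean; L2 \<le> upper_mean; 0 < s; s < 1;
       \<And>x. L x = s * L1 x + (1 - s) * L2 x\<rbrakk> \<Longrightarrow> L1 = L"
    using extreme_dominated_functional[OF sublinear_upper_mean, of f] by blast
  have L_bsup: "L g \<le> bsup g" for g
    using le_funD[OF L(2), of g] upper_mean_le[OF subspace_0[OF subspace_coboundaries], of g] by simp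
  have L_cob: "L g = 0" if g: "g \<in> coboundaries T" for g
  proof -
    have le: "L k \<le> 0" if k: "k \<in> coboundaries T" for k
      using le_funD[OF L(2), of k] upper_mean_le[OF subspace_neg[OF subspace_coboundaries k], of k]
      by (simp add: sublinear_zero[OF sublinear_bsup])
    show ?thesis
      using le[OF g] le[OF subspace_neg[OF subspace_coboundaries g]] by (simp add: linear_neg[OF L(1)])
  qed
  have L_nonneg: "0 \<le> L g" if "\<And>x. 0 \<le> apply_bcontfun g x" for g
    using L_bsup[of "- g"] bsup_least[of "- g" 0] that by (simp add: linear_neg[OF L(1)])
  have L_one: "L (const_bcontfun 1) = 1"
  proof -
    let ?one = "const_bcontfun 1 :: 'a \<Rightarrow>\<^sub>C real"
    have "bsup ?one \<le> 1" "bsup (- ?one) \<le> - 1" by (auto intro: bsup_least)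
    then show ?thesis
      using L_bsup[of ?one] L_bsup[of "- ?one"] by (simp add: linear_neg[OF L(1)])
  qed
  obtain M where M: "prob_space M" "sets M = sets borel" and int: "\<And>g. (\<integral>x. apply_bcontfun g x \<partial>M) = L g"
    using riesz_representation[OF compact zero_set L(1) L_nonneg L_one] by blast
  interpret prob_space M by (rule M)
  have sp: "space M = UNIV" using sets_eq_imp_space_eq[OF M(2)] by simp
  have T_meas: "T \<in> measurable M borel"
    using borel_measurable_continuous_onI[OF T] M(2) by (simp cong: measurable_cong_sets)
  have inv: "distr M borel T = M"
  proof (rule measure_eqI_continuous[OF compact zero_set])
    show "finite_measure (distr M borel T)" by (rule finite_measure_distr[OF T_meas])
    fix u :: "'a \<Rightarrow> real" assume u: "continuous_on UNIV u"
    define g where "g = Bcontfun u"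
    have g: "apply_bcontfun g x = u x" for x unfolding g_def by (rule apply_Bcontfun[OF compact zero_set u])
    have "(\<integral>x. u x \<partial>distr M borel T) = (\<integral>x. apply_bcontfun (koopman T g) x \<partial>M)"
      using borel_measurable_continuous_onI[OF u] by (simp add: integral_distr[OF T_meas] apply_koopman[OF T] g)
    also have "\<dots> = L g"
      using L_cob[of "koopman T g - g"] by (simp add: int coboundaries_def linear_diff[OF L(1)])
    finally show "(\<integral>x. u x \<partial>distr M borel T) = (\<integral>x. u x \<partial>M)" using int[of g] by (simp add: g)
  qed (simp_all add: M finite_measure_axioms)
  have "measure M A = 0 \<or> measure M A = 1" if A: "A \<in> sets borel" "T -` A = A" for A
  proof (rule ccontr)
    assume "\<not> ?thesis"
    then have s: "0 < measure M A" "measure M A < 1"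
      using measure_nonneg[of M A] prob_le_1[of A] by linarith+
    have cA: "- A \<in> sets borel" "T -` (- A) = - A" using A by auto
    have mc: "measure M (- A) = 1 - measure M A"
      using prob_compl[of A] A M(2) by (simp add: sp Compl_eq_Diff_UNIV)
    define L1 where "L1 g = (\<integral>x. indicator A x * apply_bcontfun g x \<partial>M) / measure M A" for g
    define L2 where "L2 g = (\<integral>x. indicator (- A) x * apply_bcontfun g x \<partial>M) / measure M (- A)" for g
    have L1: "linear L1" "L1 \<le> upper_mean"
      unfolding L1_def using conditional_functional_le[OF M inv A s(1)] by auto
    have L2: "linear L2" "L2 \<le> upper_mean"
      unfolding L2_def using conditional_functional_le[OF M inv cA] s mc by auto
    have ind_int: "integrable M (\<lambda>x. indicator B x * apply_bcontfun g x)"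
      if "B \<in> sets borel" for B and g :: "'a \<Rightarrow>\<^sub>C real"
      using integrable_real_mult_indicator[OF _ integrable_bcontfun[OF finite_measure_axioms M(2)], of B g] that M(2)
      by (simp add: mult.commute)
    have "L g = measure M A * L1 g + (1 - measure M A) * L2 g" for g
    proof -
      have "L g = (\<integral>x. indicator A x * apply_bcontfun g x + indicator (- A) x * apply_bcontfun g x \<partial>M)"
        unfolding int[symmetric] by (intro Bochner_Integration.integral_cong) (auto simp: indicator_def)
      also have "\<dots> = (\<integral>x. indicator A x * apply_bcontfun g x \<partial>M) + (\<integral>x. indicator (- A) x * apply_bcontfun g x \<partial>M)"
        using ind_int A cA by (intro Bochner_Integration.integral_add) auto
      finally show ?thesis using s by (simp add: L1_def L2_def mc)
    qed
    then have "L1 = L" using L1 L2 s by (intro extreme[of L1 L2 "measure M A"])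
    then have eq: "(\<integral>x. indicator A x * apply_bcontfun g x \<partial>M) = measure M A * L g" for g
      using s by (auto simp: L1_def fun_eq_iff field_simps)
    \<comment> \<open>D is M restricted to A. Its integrals are those of \<open>measure M A\<close>
      times M, so the two agree on - A as well, where D is zero and the multiple of M is
      positive.\<close>
    define D where "D = density M (\<lambda>x. ennreal (indicator A x))"
    have D_emeasure: "emeasure D B = emeasure M (A \<inter> B)" if "B \<in> sets borel" for B
      unfolding D_def ennreal_indicator using A that M(2) by (intro emeasure_restricted) auto
    have D: "finite_measure D" "sets D = sets borel"
    proof -
      show "sets D = sets borel" by (simp add: D_def M(2))
      then show "finite_measure D"
        using D_emeasure[of UNIV] by (intro finite_measureI) (simp add: D_def sp)
    qed
    have "(\<Sum>i\<in>UNIV. (if i then 1 else - measure M A) * measure (if i then D else M) (- A)) = 0"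
    proof (rule signed_measure_zero[OF compact zero_set])
      fix u :: "'a \<Rightarrow> real" assume u: "continuous_on UNIV u"
      define g where "g = Bcontfun u"
      have g: "apply_bcontfun g x = u x" for x unfolding g_def by (rule apply_Bcontfun[OF compact zero_set u])
      have "(\<integral>x. u x \<partial>D) = (\<integral>x. indicator A x * u x \<partial>M)"
        unfolding D_def using A(1) M(2) borel_measurable_continuous_onI[OF u]
        by (subst integral_density) (auto cong: measurable_cong_sets)
      then show "(\<Sum>i\<in>UNIV. (if i then 1 else - measure M A) * (\<integral>x. u x \<partial>(if i then D else M))) = 0"
        using eq[of g] int[of g] by (simp add: UNIV_bool g)
    qed (use D M cA finite_measure_axioms in \<open>auto split: if_splits\<close>)
    moreover have "measure D (- A) = 0"
      using D_emeasure[OF cA(1)] by (simp add: measure_def)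
    ultimately show False using s by (simp add: UNIV_bool mc)
  qed
  then have "M \<in> ergodic_measures T" using M inv by (auto simp: ergodic_measures_def)
  then show thesis using that int[of f] L(3) by simp
qed

text \<open>An invariant integral is continuous and kills coboundaries, hence their closure.
  Conversely \<open>upper_mean f\<close> and \<open>upper_mean (- f)\<close> are themselves ergodic
  integrals of f and - f, so both vanish.\<close>

lemma closure_coboundaries_iff:
  "f \<in> closure (coboundaries T) \<longleftrightarrow> (\<forall>M\<in>ergodic_measures T. (\<integral>x. apply_bcontfun f x \<partial>M) = 0)"
proof
  assume f: "f \<in> closure (coboundaries T)"
  show "\<forall>M\<in>ergodic_measures T. (\<integral>x. apply_bcontfun f x \<partial>M) = 0"
  proof
    fix M assume M: "M \<in> ergodic_measures T"
    note M = ergodic_measuresD[OF M]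
    interpret prob_space M by (rule M)
    define \<Lambda> where "\<Lambda> g = (\<integral>x. apply_bcontfun g x \<partial>M)" for g :: "'a \<Rightarrow>\<^sub>C real"
    have lin: "linear \<Lambda>" unfolding \<Lambda>_def by (rule linear_integral_bcontfun[OF finite_measure_axioms M(1)])
    have "bounded_linear \<Lambda>"
    proof (rule bounded_linear_intro[where K = 1])
      show "norm (\<Lambda> g) \<le> norm g * 1" for g
        using abs_integral_le_norm[OF prob_space_axioms M(1), of g] by (simp add: \<Lambda>_def)
    qed (use lin in \<open>simp_all add: linear_add linear_scale\<close>)
    then have "closed {g. \<Lambda> g = 0}"
      by (intro closed_Collect_eq continuous_on_const linear_continuous_on)
    moreover have "coboundaries T \<subseteq> {g. \<Lambda> g = 0}"
      using integral_koopman[OF M(1,3)] by (auto simp: coboundaries_def linear_diff[OF lin]) (simp add: \<Lambda>_def)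
    ultimately show "(\<integral>x. apply_bcontfun f x \<partial>M) = 0"
      using closure_minimal[of "coboundaries T" "{g. \<Lambda> g = 0}"] f by (auto simp: \<Lambda>_def)
  qed
next
  assume zero: "\<forall>M\<in>ergodic_measures T. (\<integral>x. apply_bcontfun f x \<partial>M) = 0"
  show "f \<in> closure (coboundaries T)"
  proof (rule upper_mean_nonpos_imp_closure)
    show "upper_mean f \<le> 0" using ex_ergodic_measure_integral[of f] zero by (metis order_refl)
    show "upper_mean (- f) \<le> 0" using ex_ergodic_measure_integral[of "- f"] zero by force
  qed
qed

subsection \<open>The multiplicity\<close>

text \<open>With fewer generators than measures, a nonzero combination \<Lambda> of ergodic
  integrals vanishes on representatives of all generators. It is bounded and vanishes on N, so
  density makes it zero everywhere, against independence.\<close>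

lemma card_ergodic_le:
  assumes F: "F \<subseteq> nv_carrier (quotient_nspace (closure (coboundaries T)))" "finite F"
    and dense: "nv_dense (quotient_nspace (closure (coboundaries T)))
      (nv_span (quotient_nspace (closure (coboundaries T))) F)"
    and I: "I \<subseteq> ergodic_measures T" "finite I"
  shows "card I \<le> card F"
proof (rule ccontr)
  assume "\<not> ?thesis"
  then have less: "card F < card I" by simp
  define N where "N = closure (coboundaries T)"
  have N: "subspace N" unfolding N_def by (rule subspace_closure_coboundaries[OF T])
  note D = ergodic_measuresD[OF subsetD[OF I(1)]]
  have fin: "finite_measure M" if "M \<in> I" for M using D(2)[OF that] by (simp add: prob_space_def)
  have "\<exists>r. f = r +o N" if "f \<in> F" for f
    using F(1) that by (auto simp: quotient_nspace_def N_def)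
  then obtain r where r: "\<And>f. f \<in> F \<Longrightarrow> f = r f +o N" by metis
  obtain c where c: "\<exists>M\<in>I. c M \<noteq> 0" "\<forall>f\<in>F. (\<Sum>M\<in>I. c M * (\<integral>x. apply_bcontfun (r f) x \<partial>M)) = 0"
    using homogeneous_system_solution[OF F(2) I(2) less, of "\<lambda>f M. \<integral>x. apply_bcontfun (r f) x \<partial>M"] by blast
  define \<Lambda> where "\<Lambda> g = (\<Sum>M\<in>I. c M * (\<integral>x. apply_bcontfun g x \<partial>M))" for g :: "'a \<Rightarrow>\<^sub>C real"
  have lin: "linear \<Lambda>"
  proof (rule linearI)
    fix f g :: "'a \<Rightarrow>\<^sub>C real" and b :: real
    note l = linear_integral_bcontfun[OF fin D(1)]
    show "\<Lambda> (f + g) = \<Lambda> f + \<Lambda> g"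
      unfolding \<Lambda>_def sum.distrib[symmetric]
      by (intro sum.cong refl) (simp add: linear_add[OF l] distrib_left del: plus_bcontfun.rep_eq)
    show "\<Lambda> (b *\<^sub>R f) = b *\<^sub>R \<Lambda> f"
      unfolding \<Lambda>_def scaleR_sum_right
      by (intro sum.cong refl) (simp add: linear_scale[OF l] del: scaleR_bcontfun.rep_eq)
  qed
  have \<Lambda>_N: "\<Lambda> g = 0" if "g \<in> N" for g
    using that closure_coboundaries_iff[of g] I(1) by (auto simp: \<Lambda>_def N_def intro!: sum.neutral)
  have \<Lambda>_norm: "\<bar>\<Lambda> g\<bar> \<le> (\<Sum>M\<in>I. \<bar>c M\<bar>) * norm g" for g
  proof -
    have "\<bar>\<integral>x. apply_bcontfun g x \<partial>M\<bar> \<le> norm g" if M: "M \<in> I" for M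
    proof -
      interpret prob_space M by (rule D(2)[OF M])
      show ?thesis by (rule abs_integral_le_norm[OF prob_space_axioms D(1)[OF M]])
    qed
    then have "\<bar>\<Lambda> g\<bar> \<le> (\<Sum>M\<in>I. \<bar>c M\<bar> * norm g)"
      unfolding \<Lambda>_def
      by (intro order_trans[OF sum_abs] sum_mono) (simp add: abs_mult mult_left_mono)
    then show ?thesis by (simp add: sum_distrib_right)
  qed
  have span: "\<exists>w. y = w +o N \<and> \<Lambda> w = 0" if "y \<in> nv_span (quotient_nspace N) F" for y
    using that
  proof induction
    case zero
    show ?case by (intro exI[of _ 0]) (simp add: quotient_nspace_def linear_0[OF lin])
  next
    case (base f)
    then show ?case using r c(2) by (intro exI[of _ "r f"]) (simp add: \<Lambda>_def)
  next
    case (add y z)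
    then obtain v w where "y = v +o N" "\<Lambda> v = 0" "z = w +o N" "\<Lambda> w = 0" by blast
    then show ?case
      by (intro exI[of _ "v + w"]) (simp add: quotient_nspace_def coset_add[OF N] linear_add[OF lin])
  next
    case (scale y b)
    then obtain w where "y = w +o N" "\<Lambda> w = 0" by blast
    then show ?case
      by (intro exI[of _ "b *\<^sub>R w"]) (simp add: quotient_nspace_def coset_scale[OF N] linear_scale[OF lin])
  qed
  have zero: "\<Lambda> g = 0" for g
  proof -
    define K where "K = (\<Sum>M\<in>I. \<bar>c M\<bar>)"
    have K: "0 \<le> K" by (simp add: K_def sum_nonneg)
    have "\<bar>\<Lambda> g\<bar> \<le> 0 + e" if e: "0 < e" for e
    proof -
      \<comment> \<open>The summand 1 keeps the denominator positive even for K = 0.\<close>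
      define d where "d = e / (K + 1)"
      have d: "0 < d" "K * d \<le> e" using e K by (auto simp: d_def field_simps)
      have "g +o N \<in> nv_carrier (quotient_nspace N)" by (simp add: quotient_nspace_def)
      then obtain y where y: "y \<in> nv_span (quotient_nspace N) F"
        "nv_norm (quotient_nspace N) (nv_minus (quotient_nspace N) (g +o N) y) < d"
        using dense d(1) unfolding nv_dense_def N_def[symmetric] by blast
      obtain w where w: "y = w +o N" "\<Lambda> w = 0" using span[OF y(1)] by blast
      have "nv_minus (quotient_nspace N) (g +o N) y = (g - w) +o N"
        using coset_scale[OF N, of "- 1" w] coset_add[OF N, of g "- w"]
        by (simp add: nv_minus_def quotient_nspace_def w)
      then have "(INF z\<in>(g - w) +o N. norm z) < d" using y(2) by (simp add: quotient_nspace_def)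
      moreover have "(g - w) +o N \<noteq> {}" using subspace_0[OF N] by (auto simp: elt_set_plus_def)
      ultimately obtain z where z: "z \<in> (g - w) +o N" "norm z < d"
        using cInf_lessD[of "norm ` ((g - w) +o N)" d] by auto
      \<comment> \<open>z and g - w lie in the same coset, so \<Lambda> takes the same value at
        both, while the norm of z is below d.\<close>
      have "\<Lambda> (z - (g - w)) = 0" using z(1) by (intro \<Lambda>_N) (simp add: coset_iff)
      then have "\<Lambda> g = \<Lambda> z" using w(2) by (simp add: linear_diff[OF lin])
      also have "\<bar>\<Lambda> z\<bar> \<le> K * norm z" unfolding K_def by (rule \<Lambda>_norm)
      also have "\<dots> \<le> K * d" using z(2) K by (intro mult_left_mono) auto
      finally show ?thesis using d(2) by simp
    qed
    then have "\<bar>\<Lambda> g\<bar> \<le> 0" by (rule field_le_epsilon)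
    then show ?thesis by simp
  qed
  have signed: "(\<Sum>M\<in>I. c M * measure M A) = 0" if "A \<in> sets borel" for A
  proof (rule signed_measure_zero[OF compact zero_set I(2) D(1) fin _ that])
    fix u :: "'a \<Rightarrow> real" assume u: "continuous_on UNIV u"
    show "(\<Sum>M\<in>I. c M * (\<integral>x. u x \<partial>M)) = 0"
      using zero[of "Bcontfun u"] by (simp add: \<Lambda>_def apply_Bcontfun[OF compact zero_set u])
  qed
  have "c M = 0" if "M \<in> I" for M
    by (rule ergodic_measures_independent[OF T S ST TS I(2,1) that signed])
  then show False using c(1) by blast
qed

text \<open>A vector w of the span of G with the same ergodic integrals as v differs from v by an
  element of N. So the cosets of G span the whole quotient, and each y is approximated by
  itself.\<close>

lemma ex_dense_span:
  assumes "finite (ergodic_measures T)"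
  obtains F where "F \<subseteq> nv_carrier (quotient_nspace (closure (coboundaries T)))" "finite F"
    "card F \<le> card (ergodic_measures T)"
    "nv_dense (quotient_nspace (closure (coboundaries T)))
      (nv_span (quotient_nspace (closure (coboundaries T))) F)"
proof -
  define N where "N = closure (coboundaries T)"
  have N: "subspace N" unfolding N_def by (rule subspace_closure_coboundaries[OF T])
  interpret Q: normed_space "quotient_nspace N"
    by (rule normed_space_quotient_nspace[OF N]) (simp add: N_def)
  define \<Lambda> where "\<Lambda> M g = (\<integral>x. apply_bcontfun g x \<partial>M)" for M and g :: "'a \<Rightarrow>\<^sub>C real"
  have lin: "linear (\<Lambda> M)" if "M \<in> ergodic_measures T" for M
    unfolding \<Lambda>_def using ergodic_measuresD(1,2)[OF that]
    by (intro linear_integral_bcontfun) (simp_all add: prob_space_def)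
  obtain G where G: "finite G" "card G \<le> card (ergodic_measures T)"
    "\<And>v. \<exists>w\<in>span G. \<forall>M\<in>ergodic_measures T. \<Lambda> M w = \<Lambda> M v"
    using finite_functionals_span[OF assms, of \<Lambda>] lin by auto
  define F where "F = (\<lambda>x. x +o N) ` G"
  have span: "w +o N \<in> nv_span (quotient_nspace N) F" if "w \<in> span G" for w
    using that
  proof (induction rule: span_induct_alt)
    case base
    show ?case using nv_span.zero[of "quotient_nspace N" F] by (simp add: quotient_nspace_def)
  next
    case (step b x y)
    have "x +o N \<in> nv_span (quotient_nspace N) F" using step(1) by (intro nv_span.base) (simp add: F_def)
    then have "nv_add (quotient_nspace N) (nv_scale (quotient_nspace N) b (x +o N)) (y +o N)
        \<in> nv_span (quotient_nspace N) F"
      using step by (intro nv_span.add nv_span.scale)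
    then show ?case by (simp add: quotient_nspace_def coset_scale[OF N] coset_add[OF N])
  qed
  show thesis
  proof (rule that[of F, folded N_def])
    show "F \<subseteq> nv_carrier (quotient_nspace N)" by (auto simp: F_def quotient_nspace_def)
    show "finite F" using G(1) by (simp add: F_def)
    show "card F \<le> card (ergodic_measures T)"
      using G(1,2) card_image_le[of G "\<lambda>x. x +o N"] by (simp add: F_def)
    show "nv_dense (quotient_nspace N) (nv_span (quotient_nspace N) F)"
      unfolding nv_dense_def
    proof (intro ballI allI impI)
      fix y and e :: real assume y: "y \<in> nv_carrier (quotient_nspace N)" and e: "0 < e"
      obtain v where v: "y = v +o N" using y by (auto simp: quotient_nspace_def)
      obtain w where w: "w \<in> span G" "\<forall>M\<in>ergodic_measures T. \<Lambda> M w = \<Lambda> M v" using G(3) by blast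
      have "v - w \<in> N"
        unfolding N_def closure_coboundaries_iff
      proof
        fix M assume M: "M \<in> ergodic_measures T"
        have "\<Lambda> M (v - w) = 0" using w(2) M by (simp add: linear_diff[OF lin[OF M]])
        then show "(\<integral>x. apply_bcontfun (v - w) x \<partial>M) = 0" by (simp add: \<Lambda>_def)
      qed
      then have "y = w +o N" using coset_eq_iff[OF N] v by blast
      then have "y \<in> nv_span (quotient_nspace N) F" using span[OF w(1)] by simp
      moreover have "nv_norm (quotient_nspace N) (nv_minus (quotient_nspace N) y y) < e"
        using Q.minus_self[OF y] Q.norm_eq_zero[OF Q.zero_closed] e by simp
      ultimately show "\<exists>z\<in>nv_span (quotient_nspace N) F. nv_norm (quotient_nspace N) (nv_minus (quotient_nspace N) y z) < e"
        by blast
    qed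
  qed
qed

lemma nv_power_int_induced_koopman:
  assumes x: "x \<in> nv_carrier (quotient_nspace (closure (coboundaries T)))"
  shows "nv_power_int (quotient_nspace (closure (coboundaries T)))
    (induced_map (closure (coboundaries T)) (koopman T)) n x = x"
proof -
  define N where "N = closure (coboundaries T)"
  define E where "E = quotient_nspace N"
  define U where "U = induced_map N (koopman T)"
  have N: "subspace N" unfolding N_def by (rule subspace_closure_coboundaries[OF T])
  have U: "U y = y" if y: "y \<in> nv_carrier E" for y
  proof -
    obtain v where v: "y = v +o N" using y by (auto simp: E_def quotient_nspace_def)
    have "koopman T v - v \<in> coboundaries T" by (simp add: coboundaries_def)
    then have "koopman T v - v \<in> N" unfolding N_def using closure_subset by blast
    then have "koopman T v +o N = v +o N" using coset_eq_iff[OF N] by blast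
    then show ?thesis
      using induced_map_coset[OF linear_koopman[OF T] N] koopman_closure_coboundaries[OF T]
      by (simp add: U_def v N_def)
  qed
  \<comment> \<open>Negative powers iterate \<open>inv_into\<close>, which is determined here
    because U, acting as the identity, is injective on the carrier.\<close>
  have inv: "inv_into (nv_carrier E) U y = y" if y: "y \<in> nv_carrier E" for y
    using inv_into_f_eq[of U "nv_carrier E" y y] U y by (auto simp: inj_on_def)
  have x': "x \<in> nv_carrier E" using x by (simp add: E_def N_def)
  have "(U ^^ k) x = x" "(inv_into (nv_carrier E) U ^^ k) x = x" for k
    by (induction k) (simp_all add: U[OF x'] inv[OF x'])
  then show ?thesis by (simp add: nv_power_int_def E_def U_def N_def)
qed

text \<open>A finite generating set bounds the size of every finite set of ergodic measures, so
  infinitely many of these exclude finite generating sets and both sides are \<infinity>. When they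
  are finitely many, \<open>ex_dense_span\<close> supplies a generating set that is small
  enough.\<close>

lemma Mult_induced_koopman:
  "Mult (quotient_nspace (closure (coboundaries T))) (induced_map (closure (coboundaries T)) (koopman T))
    = ecard (ergodic_measures T)"
proof -
  define E where "E = quotient_nspace (closure (coboundaries T))"
  define U where "U = induced_map (closure (coboundaries T)) (koopman T)"
  \<comment> \<open>Orbits are single points, so F itself replaces the union of its orbits in the
    definition of \<open>Mult\<close>.\<close>
  have orbit: "{nv_power_int E U n x | n x. x \<in> F} = F" if "F \<subseteq> nv_carrier E" for F
    using nv_power_int_induced_koopman that unfolding E_def U_def by (auto simp: subset_iff) metis
  have Mult: "Mult E U = Inf {ecard F | F. F \<subseteq> nv_carrier E \<and> nv_dense E (nv_span E F)}"
    unfolding Mult_def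
    by (intro arg_cong[where f = Inf] Collect_cong ex_cong1 conj_cong refl) (simp add: orbit)
  have "ecard (ergodic_measures T) \<le> ecard F"
    if F: "F \<subseteq> nv_carrier E" "nv_dense E (nv_span E F)" for F
  proof (cases "finite F")
    case True
    have le: "card I \<le> card F" if "I \<subseteq> ergodic_measures T" "finite I" for I
      using card_ergodic_le[OF F(1)[unfolded E_def] True F(2)[unfolded E_def] that] .
    have "finite (ergodic_measures T)"
    proof (rule ccontr)
      assume "infinite (ergodic_measures T)"
      then obtain I where "I \<subseteq> ergodic_measures T" "finite I" "card I = Suc (card F)"
        using infinite_arbitrarily_large by blast
      then show False using le[of I] by simp
    qed
    then show ?thesis using le[of "ergodic_measures T"] True by (simp add: ecard_def)
  qed (simp add: ecard_def)
  then have "ecard (ergodic_measures T) \<le> Mult E U"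
    unfolding Mult by (intro Inf_greatest) auto
  moreover have "Mult E U \<le> ecard (ergodic_measures T)"
  proof (cases "finite (ergodic_measures T)")
    case True
    then obtain F where F: "F \<subseteq> nv_carrier E" "finite F" "card F \<le> card (ergodic_measures T)"
      "nv_dense E (nv_span E F)"
      unfolding E_def by (rule ex_dense_span)
    then have "Mult E U \<le> ecard F" unfolding Mult by (intro Inf_lower) auto
    also have "\<dots> \<le> ecard (ergodic_measures T)" using F True by (simp add: ecard_def)
    finally show ?thesis .
  qed (simp add: ecard_def)
  ultimately show ?thesis unfolding E_def U_def by (rule antisym[rotated])
qed

end

theorem lemma2p6:
  fixes T :: "'a::topological_space \<Rightarrow> 'a"
  assumes "compact_space (euclidean :: 'a topology)"
    and "metrizable_space (euclidean :: 'a topology)"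
    and "homeomorphic_map euclidean euclidean T"
  shows "Mult (quotient_nspace (closure (coboundaries T)))
           (induced_map (closure (coboundaries T)) (koopman T))
         = ecard (ergodic_measures T)"
proof -
  have compact: "compact (UNIV :: 'a set)"
    using assms(1) by (simp add: compact_space_def)
  have zero_set: "\<exists>h. continuous_on UNIV h \<and> (\<forall>x. (0::real) \<le> h x) \<and> C = {x. h x = 0}"
    if "closed C" for C :: "'a set"
    using metrizable_closed_zero_set[OF assms(2) that] by metis
  obtain S where "homeomorphic_maps euclidean euclidean T S"
    using assms(3) by (auto simp: homeomorphic_map_maps)
  then have S: "continuous_on UNIV T" "continuous_on UNIV S" "\<And>x. S (T x) = x" "\<And>x. T (S x) = x"
    by (auto simp: homeomorphic_maps_def)
  show ?thesis by (rule Mult_induced_koopman) (fact compact zero_set S)+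
qed

end
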